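(* If an element of $\mathrm{Rev}_{marq}$ (the set of marked colourings of the Rubik's Revenge) is chosen uniformly at random, the probability that it is solvable, i.e. that it lies in $\mathcal{I}\cdot x_0\cdot\mathcal{L}$, is $$\frac{\#(\mathcal{I}\cdot x_0\cdot\mathcal{L})}{\#\mathrm{Rev}_{marq}}=\frac{1}{3\cdot 2^{12}}.$$
   Context: $C_n=\mathbf{Z}/n\mathbf{Z}$; $\mathfrak{S}(X)$ is the group of permutations of a set $X$. Geometric pieces. Model the $4\times4\times4$ cube by the 56 cubies $c\in\{-3,-1,1,3\}^3$ having at least one coordinate equal to $\pm3$. A (geometric) facet is a pair $(c,n)$ with $c$ a cubie and $n\in\{\pm e_1,\pm e_2,\pm e_3\}$ such that $\langle c,n\rangle=3$; put $p(c,n)=c$. $\mathrm{ArGeom}$ (24 edges), $\mathrm{SomGeom}$ (8 corners), $\mathrm{CentGeom}$ (24 centres) are the sets of cubies with exactly two, three, one coordinates equal to $\pm3$. $C_2$ acts on the facets of edges by exchanging the two facets of each edge; the generator of $C_3$ acts on the three facets of each corner $c$ by the direct rotation of angle $2\pi/3$ about the axis oriented from $c$ to the origin. Material pieces. $\mathrm{Coul}=\{\mathrm{Bla},\mathrm{J},\mathrm{Ble},\mathrm{V},\mathrm{O},\mathrm{R}\}$, with opposite pairs $\{\mathrm{Bla},\mathrm{J}\},\{\mathrm{Ble},\mathrm{V}\},\{\mathrm{O},\mathrm{R}\}$. $\mathrm{ArMat}$ is the set of pairs $(P,j)$, $P$ one of the 12 pairs of non-opposite distinct colours, $j\in\{1,2\}$;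 its facets are $(P,j,c)$, $c\in P$, and $C_2$ exchanges the two facets of each material edge. $\mathrm{SomMat}$ is the set of the 8 triples of pairwise non-opposite distinct colours, the facets of a triple being its colours, with the generator of $C_3$ acting by the cyclic permutations $[\mathrm{Bla},\mathrm{Ble},\mathrm{R}]$, $[\mathrm{Bla},\mathrm{O},\mathrm{Ble}]$, $[\mathrm{Bla},\mathrm{V},\mathrm{O}]$, $[\mathrm{Bla},\mathrm{R},\mathrm{V}]$, $[\mathrm{J},\mathrm{R},\mathrm{Ble}]$, $[\mathrm{J},\mathrm{Ble},\mathrm{O}]$, $[\mathrm{J},\mathrm{V},\mathrm{R}]$, $[\mathrm{J},\mathrm{O},\mathrm{V}]$ ($[a,b,c]$ meaning $a\mapsto b\mapsto c\mapsto a$). $\mathrm{CentMat}=\mathrm{Coul}\times\{1,2,3,4\}$, each having one facet. Colourings. An isomorphism of $C_k$-bundles between two such sets of pieces is a pair $(f,F)$ with $f$ a bijection of pieces and $F$ a $C_k$-equivariant bijection of facets lying over $f$ (a facet of a piece $a$ is sent to a facet of $f(a)$). $\mathrm{Rev}_{marq}$ is the set of triples $(\mathfrak{f},\mathfrak{g},h)$ where $\mathfrak{f}:\mathrm{ArGeom}\to\mathrm{ArMat}$ is an isomorphism of $C_2$-bundles, $\mathfrak{g}:\mathrm{SomGeom}\to\mathrm{SomMat}$ is an isomorphism of $C_3$-bundles and $h:\mathrm{CentGeom}\to\mathrm{CentMat}$ is a bijection. Let $\mathcal{T}_{geom}=\mathrm{Aut}_{C_2}(\mathrm{ArGeom})\times\mathrm{Aut}_{C_3}(\mathrm{SomGeom})\times\mathfrak{S}(\mathrm{CentGeom})$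 and $\mathcal{T}_{mat}=\mathrm{Aut}_{C_2}(\mathrm{ArMat})\times\mathrm{Aut}_{C_3}(\mathrm{SomMat})\times\mathfrak{S}(\mathrm{CentMat})$ (bundle automorphisms). $\mathcal{T}_{mat}$ acts on the left and $\mathcal{T}_{geom}$ on the right of $\mathrm{Rev}_{marq}$ by composition. Legal moves. For $i\in\{1,2,3\}$ and $v\in\{-3,-1,1,3\}$, the elementary slice move is the permutation of the facets sending $(c,n)$ to $(Rc,Rn)$ if $c_i=v$ and fixing $(c,n)$ otherwise, where $R$ is the rotation by a quarter turn about the axis $e_i$. These 12 moves define elements of $\mathcal{T}_{geom}$; $\mathcal{L}\subset\mathcal{T}_{geom}$ is the subgroup they generate. Indistinguishable transformations. $\mathcal{I}=\mathcal{I}(\mathrm{ArMat})\times\{1\}\times\mathcal{I}(\mathrm{CentMat})\subset\mathcal{T}_{mat}$, where $\mathcal{I}(\mathrm{ArMat})$ is the group of $C_2$-bundle automorphisms of $\mathrm{ArMat}$ whose map on facets preserves the colour of each facet and the colour pair of each edge (i.e. $(P,j,c)\mapsto(P,j',c)$), and $\mathcal{I}(\mathrm{CentMat})$ is the group of permutations of $\mathrm{CentMat}$ preserving the colour. Solved state. Put $\mathrm{col}(e_1)=\mathrm{R}$, $\mathrm{col}(-e_1)=\mathrm{O}$, $\mathrm{col}(e_2)=\mathrm{Ble}$, $\mathrm{col}(-e_2)=\mathrm{V}$, $\mathrm{col}(e_3)=\mathrm{Bla}$, $\mathrm{col}(-e_3)=\mathrm{J}$. The solved state $x_0=(\mathfrak{f},\mathfrak{g},h)\in\mathrm{Rev}_{marq}$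 is a fixed element sending each facet $(c,n)$ to a material facet of colour $\mathrm{col}(n)$. *)

theory Defs
  imports
    "HOL-Algebra.Bij"
    "HOL-Algebra.Generated_Groups"
    "HOL-Combinatorics.Cycles"
    "HOL-Library.Product_Plus"
    "HOL-Probability.Probability_Mass_Function"
begin

section \<open>Bundles of pieces and facets\<close>

text \<open>
  A set of pieces with facets, together with an action of the cyclic group of order \<open>k\<close> on the
  facets. The action is recorded by its generator: the class of \<open>m\<close> acts as \<open>gen ^^ m\<close>.
  All maps between finite sets are extensional functions, so that they can be counted.
\<close>

record ('p, 'f) piece_bundle =
  Pieces :: "'p set"
  Facets :: "'f set"
  proj :: "'f \<Rightarrow> 'p"
  gen :: "'f \<Rightarrow> 'f"

definition ext_bij :: "'a set \<Rightarrow> 'b set \<Rightarrow> ('a \<Rightarrow> 'b) set" where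
  "ext_bij A B = {f \<in> extensional A. bij_betw f A B}"

definition bundle_iso ::
    "nat \<Rightarrow> ('p, 'f) piece_bundle \<Rightarrow> ('q, 'g) piece_bundle \<Rightarrow> (('p \<Rightarrow> 'q) \<times> ('f \<Rightarrow> 'g)) set" where
  "bundle_iso k A B =
    {(f, F). f \<in> ext_bij (Pieces A) (Pieces B) \<and> F \<in> ext_bij (Facets A) (Facets B) \<and>
       (\<forall>x\<in>Facets A. proj B (F x) = f (proj A x)) \<and>
       (\<forall>m<k. \<forall>x\<in>Facets A. F ((gen A ^^ m) x) = (gen B ^^ m) (F x))}"

definition bundle_Aut :: "nat \<Rightarrow> ('p, 'f) piece_bundle \<Rightarrow> (('p \<Rightarrow> 'p) \<times> ('f \<Rightarrow> 'f)) monoid" where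
  "bundle_Aut k A =
    (BijGroup (Pieces A) \<times>\<times> BijGroup (Facets A)) \<lparr>carrier := bundle_iso k A A\<rparr>"

definition bundle_comp ::
    "('p, 'f) piece_bundle \<Rightarrow> ('q \<Rightarrow> 'r) \<times> ('g \<Rightarrow> 'h) \<Rightarrow> ('p \<Rightarrow> 'q) \<times> ('f \<Rightarrow> 'g) \<Rightarrow>
      ('p \<Rightarrow> 'r) \<times> ('f \<Rightarrow> 'h)" where
  "bundle_comp A g f =
    (compose (Pieces A) (fst g) (fst f), compose (Facets A) (snd g) (snd f))"

text \<open>The exchange of the two facets of a piece.\<close>

definition other_facet :: "'f set \<Rightarrow> ('f \<Rightarrow> 'p) \<Rightarrow> 'f \<Rightarrow> 'f" where
  "other_facet S pr x = (THE y. y \<in> S \<and> pr y = pr x \<and> y \<noteq> x)"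


section \<open>Geometric pieces\<close>

type_synonym vec = "int \<times> int \<times> int"

fun dot :: "vec \<Rightarrow> vec \<Rightarrow> int" where
  "dot (a1, a2, a3) (b1, b2, b3) = a1 * b1 + a2 * b2 + a3 * b3"

fun cross :: "vec \<Rightarrow> vec \<Rightarrow> vec" where
  "cross (a1, a2, a3) (b1, b2, b3) = (a2 * b3 - a3 * b2, a3 * b1 - a1 * b3, a1 * b2 - a2 * b1)"

fun scale :: "int \<Rightarrow> vec \<Rightarrow> vec" where
  "scale t (a1, a2, a3) = (t * a1, t * a2, t * a3)"

fun divide_by :: "vec \<Rightarrow> int \<Rightarrow> vec" where
  "divide_by (a1, a2, a3) t = (a1 div t, a2 div t, a3 div t)"

definition axes :: "vec set" where
  "axes = {(1, 0, 0), (0, 1, 0), (0, 0, 1)}"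

definition normals :: "vec set" where
  "normals = axes \<union> uminus ` axes"

fun extremal_coords :: "vec \<Rightarrow> nat" where
  "extremal_coords (a1, a2, a3) = length (filter (\<lambda>a. a = 3 \<or> a = -3) [a1, a2, a3])"

definition cubies :: "vec set" where
  "cubies = {c \<in> {-3, -1, 1, 3} \<times> {-3, -1, 1, 3} \<times> {-3, -1, 1, 3}. extremal_coords c \<ge> 1}"

definition geom_facets :: "(vec \<times> vec) set" where
  "geom_facets = {(c, n). c \<in> cubies \<and> n \<in> normals \<and> dot c n = 3}"

definition edge_cubies :: "vec set" where
  "edge_cubies = {c \<in> cubies. extremal_coords c = 2}"

definition corner_cubies :: "vec set" where
  "corner_cubies = {c \<in> cubies. extremal_coords c = 3}"

definition CentGeom :: "vec set" where
  "CentGeom = {c \<in> cubies. extremal_coords c = 1}"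

definition ArGeom :: "(vec, vec \<times> vec) piece_bundle" where
  "ArGeom =
    \<lparr>Pieces = edge_cubies,
     Facets = {x \<in> geom_facets. fst x \<in> edge_cubies},
     proj = fst,
     gen = other_facet {x \<in> geom_facets. fst x \<in> edge_cubies} fst\<rparr>"

text \<open>
  Rodrigues' formula for the direct rotation of angle \<open>\<theta>\<close> about the axis oriented by \<open>u\<close> reads
  \<open>cos \<theta> v + sin \<theta> (u \<times> v) / \<bar>u\<bar> + (1 - cos \<theta>) (u \<bullet> v) u / \<bar>u\<bar>\<^sup>2\<close>.
  For \<open>\<theta> = 2\<pi>/3\<close> and \<open>\<bar>u\<bar>\<^sup>2 = 27\<close> (as for \<open>u = - c\<close> with \<open>c\<close> a corner) this is
  \<open>(- 9 v + 3 (u \<times> v) + (u \<bullet> v) u) / 18\<close>, and the division is exact when \<open>v\<close> is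
  a unit coordinate vector. For \<open>\<theta> = \<pi>/2\<close> and \<open>\<bar>u\<bar> = 1\<close> it is \<open>u \<times> v + (u \<bullet> v) u\<close>.
\<close>

definition third_turn :: "vec \<Rightarrow> vec \<Rightarrow> vec" where
  "third_turn u v = divide_by (scale (-9) v + scale 3 (cross u v) + scale (dot u v) u) 18"

definition quarter_turn :: "vec \<Rightarrow> vec \<Rightarrow> vec" where
  "quarter_turn u v = cross u v + scale (dot u v) u"

definition SomGeom :: "(vec, vec \<times> vec) piece_bundle" where
  "SomGeom =
    \<lparr>Pieces = corner_cubies,
     Facets = {x \<in> geom_facets. fst x \<in> corner_cubies},
     proj = fst,
     gen = (\<lambda>(c, n). (c, third_turn (- c) n))\<rparr>"


section \<open>Material pieces\<close>

datatype colour = Blanc | Jaune | Bleu | Vert | Orange | Rouge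

fun opposite :: "colour \<Rightarrow> colour" where
  "opposite Blanc = Jaune"
| "opposite Jaune = Blanc"
| "opposite Bleu = Vert"
| "opposite Vert = Bleu"
| "opposite Orange = Rouge"
| "opposite Rouge = Orange"

definition compatible :: "colour set \<Rightarrow> bool" where
  "compatible P \<longleftrightarrow> (\<forall>a\<in>P. \<forall>b\<in>P. b \<noteq> opposite a)"

definition edge_facets_mat :: "(colour set \<times> nat \<times> colour) set" where
  "edge_facets_mat = {(P, j, a). card P = 2 \<and> compatible P \<and> j \<in> {1, 2} \<and> a \<in> P}"

definition ArMat :: "(colour set \<times> nat, colour set \<times> nat \<times> colour) piece_bundle" where
  "ArMat =
    \<lparr>Pieces = {P. card P = 2 \<and> compatible P} \<times> {1, 2},
     Facets = edge_facets_mat,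
     proj = (\<lambda>(P, j, a). (P, j)),
     gen = other_facet edge_facets_mat (\<lambda>(P, j, a). (P, j))\<rparr>"

definition corner_cycles :: "colour list list" where
  "corner_cycles =
    [[Blanc, Bleu, Rouge], [Blanc, Orange, Bleu], [Blanc, Vert, Orange], [Blanc, Rouge, Vert],
     [Jaune, Rouge, Bleu], [Jaune, Bleu, Orange], [Jaune, Vert, Rouge], [Jaune, Orange, Vert]]"

definition corner_cycle :: "colour set \<Rightarrow> colour list" where
  "corner_cycle T = (THE cs. cs \<in> set corner_cycles \<and> set cs = T)"

text \<open>A colour belongs to four triples, so a facet of a corner is a pair of a triple and one of its
  colours.\<close>

definition SomMat :: "(colour set, colour set \<times> colour) piece_bundle" where
  "SomMat =
    \<lparr>Pieces = {T. card T = 3 \<and> compatible T},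
     Facets = {(T, a). card T = 3 \<and> compatible T \<and> a \<in> T},
     proj = fst,
     gen = (\<lambda>(T, a). (T, cycle_of_list (corner_cycle T) a))\<rparr>"

definition CentMat :: "(colour \<times> nat) set" where
  "CentMat = UNIV \<times> {1, 2, 3, 4}"


section \<open>Marked colourings and the two actions\<close>

type_synonym geom_transf =
  "((vec \<Rightarrow> vec) \<times> (vec \<times> vec \<Rightarrow> vec \<times> vec)) \<times>
   ((vec \<Rightarrow> vec) \<times> (vec \<times> vec \<Rightarrow> vec \<times> vec)) \<times> (vec \<Rightarrow> vec)"

type_synonym mat_transf =
  "((colour set \<times> nat \<Rightarrow> colour set \<times> nat) \<times>
    (colour set \<times> nat \<times> colour \<Rightarrow> colour set \<times> nat \<times> colour)) \<times>
   ((colour set \<Rightarrow> colour set) \<times> (colour set \<times> colour \<Rightarrow> colour set \<times> colour)) \<times>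
   (colour \<times> nat \<Rightarrow> colour \<times> nat)"

type_synonym colouring =
  "((vec \<Rightarrow> colour set \<times> nat) \<times> (vec \<times> vec \<Rightarrow> colour set \<times> nat \<times> colour)) \<times>
   ((vec \<Rightarrow> colour set) \<times> (vec \<times> vec \<Rightarrow> colour set \<times> colour)) \<times> (vec \<Rightarrow> colour \<times> nat)"

definition Rev_marq :: "colouring set" where
  "Rev_marq = bundle_iso 2 ArGeom ArMat \<times> bundle_iso 3 SomGeom SomMat \<times> ext_bij CentGeom CentMat"

definition T_geom :: "geom_transf monoid" where
  "T_geom = bundle_Aut 2 ArGeom \<times>\<times> bundle_Aut 3 SomGeom \<times>\<times> BijGroup CentGeom"

fun left_act :: "mat_transf \<Rightarrow> colouring \<Rightarrow> colouring" where
  "left_act (a, b, s) (f, g, h) =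
    (bundle_comp ArGeom a f, bundle_comp SomGeom b g, compose CentGeom s h)"

fun right_act :: "colouring \<Rightarrow> geom_transf \<Rightarrow> colouring" where
  "right_act (f, g, h) (a, b, s) =
    (bundle_comp ArGeom f a, bundle_comp SomGeom g b, compose CentGeom h s)"


section \<open>Legal moves, indistinguishable transformations, solved states\<close>

definition slice_piece :: "vec \<Rightarrow> int \<Rightarrow> vec \<Rightarrow> vec" where
  "slice_piece e v c = (if dot c e = v then quarter_turn e c else c)"

definition slice_facet :: "vec \<Rightarrow> int \<Rightarrow> vec \<times> vec \<Rightarrow> vec \<times> vec" where
  "slice_facet e v = (\<lambda>(c, n). if dot c e = v then (quarter_turn e c, quarter_turn e n) else (c, n))"

definition slice_move :: "vec \<Rightarrow> int \<Rightarrow> geom_transf" where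
  "slice_move e v =
    ((restrict (slice_piece e v) (Pieces ArGeom), restrict (slice_facet e v) (Facets ArGeom)),
     (restrict (slice_piece e v) (Pieces SomGeom), restrict (slice_facet e v) (Facets SomGeom)),
     restrict (slice_piece e v) CentGeom)"

definition legal_moves :: "geom_transf set" where
  "legal_moves = generate T_geom {slice_move e v | e v. e \<in> axes \<and> v \<in> {-3, -1, 1, 3}}"

definition indist_edges ::
    "((colour set \<times> nat \<Rightarrow> colour set \<times> nat) \<times>
      (colour set \<times> nat \<times> colour \<Rightarrow> colour set \<times> nat \<times> colour)) set" where
  "indist_edges =
    {(f, F) \<in> carrier (bundle_Aut 2 ArMat).
       \<forall>(P, j, a) \<in> Facets ArMat. \<exists>j'. F (P, j, a) = (P, j', a)}"

definition indist_centres :: "(colour \<times> nat \<Rightarrow> colour \<times> nat) set" where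
  "indist_centres = {s \<in> carrier (BijGroup CentMat). \<forall>x \<in> CentMat. fst (s x) = fst x}"

definition indist :: "mat_transf set" where
  "indist = indist_edges \<times> {\<one>\<^bsub>bundle_Aut 3 SomMat\<^esub>} \<times> indist_centres"

definition col :: "vec \<Rightarrow> colour" where
  "col n =
    (if n = (1, 0, 0) then Rouge else if n = (-1, 0, 0) then Orange
     else if n = (0, 1, 0) then Bleu else if n = (0, -1, 0) then Vert
     else if n = (0, 0, 1) then Blanc else Jaune)"

definition solved_state :: "colouring \<Rightarrow> bool" where
  "solved_state x \<longleftrightarrow> x \<in> Rev_marq \<and>
    (case x of ((f, F), (g, G), h) \<Rightarrow>
      (\<forall>(c, n) \<in> Facets ArGeom. snd (snd (F (c, n))) = col n) \<and>
      (\<forall>(c, n) \<in> Facets SomGeom. snd (G (c, n)) = col n) \<and>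
      (\<forall>(c, n) \<in> geom_facets. c \<in> CentGeom \<longrightarrow> fst (h c) = col n))"

definition solvable_states :: "colouring \<Rightarrow> colouring set" where
  "solvable_states x0 = {left_act i (right_act x0 l) | i l. i \<in> indist \<and> l \<in> legal_moves}"

end

theory Submission
  imports Defs
begin

text \<open>
  A slice move rotates the pieces it touches, and two quantities survive every rotation.

  \<^item> Each edge cubie has one facet of chirality \<open>24\<close> and one of chirality \<open>-24\<close>
    (\<open>chirality\<close>), so an edge can never be turned over in its own place, and the permutation of the
    24 edge cubies determines what happens to their facets.
  \<^item> The twists of the eight corners add up to zero modulo 3 (\<open>corner_map_run\<close>).

  Conversely, commutators of slice moves give a cycle of three edges and a cycle of three centres that
  disturb nothing else. Together with words for an exchange of two corners and for the opposite twists
  of two corners, they show that every permutation of the edges can be combined with every corner map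
  of total twist zero and with every permutation of the centres, up to one exchange of two centres
  (\<open>word_realizing_configuration\<close>). That exchange is harmless: the two centres carry the same
  colour in the solved state, so an indistinguishable transformation undoes it.

  The solvable states therefore form a product of three independent sets (\<open>solvable_states_eq\<close>).

  \<^item> For edges, a marked colouring induces a map from the 24 facets of positive chirality to the pairs
    of a colour pair \<open>P\<close> and a colour of \<open>P\<close>. Both groups preserve the injectivity of this map, and
    two colourings for which it is injective differ by an edge permutation and an element of
    \<open>indist_edges\<close>. Injectivity fails at the pairs \<open>P\<close> in the set \<open>matched\<close>. Turning over the first
    edge of each pair in a set \<open>S\<close> changes \<open>matched\<close> by the symmetric difference with \<open>S\<close>, so the
    \<open>2 ^ 12\<close> possible values are equally frequent (\<open>card_edge_isos\<close>).
  \<^item> For corners the total twist relative to the solved state has to vanish. Spinning one corner adds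
    1 to it, so the three values are equally frequent (\<open>card_corner_isos\<close>).
  \<^item> For centres there is no condition.
\<close>



section \<open>Words in the slice moves\<close>

abbreviation slices :: "int set" where "slices \<equiv> {-3, -1, 1, 3}"

type_synonym word = "(vec \<times> int) list"

definition valid :: "word \<Rightarrow> bool" where
  "valid w \<longleftrightarrow> set w \<subseteq> axes \<times> slices"

primrec run_piece :: "word \<Rightarrow> vec \<Rightarrow> vec" where
  "run_piece [] c = c"
| "run_piece (m # w) c = slice_piece (fst m) (snd m) (run_piece w c)"

primrec run_facet :: "word \<Rightarrow> vec \<times> vec \<Rightarrow> vec \<times> vec" where
  "run_facet [] x = x"
| "run_facet (m # w) x = slice_facet (fst m) (snd m) (run_facet w x)"

text \<open>
  In the words below, \<open>X v k\<close> stands for \<open>k\<close> quarter turns of the slice at height \<open>v\<close> on the first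
  axis; words act from right to left.
\<close>

definition X :: "int \<Rightarrow> nat \<Rightarrow> word" where "X v k = replicate k ((1, 0, 0), v)"
definition Y :: "int \<Rightarrow> nat \<Rightarrow> word" where "Y v k = replicate k ((0, 1, 0), v)"
definition Z :: "int \<Rightarrow> nat \<Rightarrow> word" where "Z v k = replicate k ((0, 0, 1), v)"

lemma run_append [simp]:
  "run_piece (u @ w) c = run_piece u (run_piece w c)"
  "run_facet (u @ w) x = run_facet u (run_facet w x)"
  by (induction u) auto

lemma valid_simps [simp]:
  "valid []" "valid (m # w) \<longleftrightarrow> m \<in> axes \<times> slices \<and> valid w"
  "valid (u @ w) \<longleftrightarrow> valid u \<and> valid w"
  by (auto simp: valid_def)

lemma fst_slice_facet [simp]: "fst (slice_facet e v x) = slice_piece e v (fst x)"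
  by (auto simp: slice_facet_def slice_piece_def split: prod.splits)

lemma fst_run_facet [simp]: "fst (run_facet w x) = run_piece w (fst x)"
  by (induction w) auto

lemma run_facet_induct [consumes 1, case_names id slice]:
  assumes "valid w" "P id"
    and "\<And>e v f. e \<in> axes \<Longrightarrow> v \<in> slices \<Longrightarrow> P f \<Longrightarrow> P (slice_facet e v \<circ> f)"
  shows "P (run_facet w)"
  using assms(1)
proof (induction w)
  case (Cons m w)
  obtain e v where m: "m = (e, v)" by (cases m)
  have "run_facet (m # w) = slice_facet e v \<circ> run_facet w"
    by (auto simp: m)
  moreover have "P (slice_facet e v \<circ> run_facet w)"
    using Cons by (intro assms(3)) (auto simp: m)
  ultimately show ?case by (simp only:)
next
  case Nil
  have "run_facet [] = id" by auto
  with assms(2) show ?case by (simp only:)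
qed

lemma slice_facet_order_4:
  assumes "e \<in> axes"
  shows "slice_facet e v (slice_facet e v (slice_facet e v (slice_facet e v x))) = x"
proof -
  obtain a b c a' b' c' where "x = ((a, b, c), (a', b', c'))" by (metis prod.exhaust)
  with assms show ?thesis
    by (auto simp: axes_def slice_facet_def quarter_turn_def)
qed

text \<open>
  A slice move has order 4, so its inverse is the word that repeats it three times.
\<close>

lemma inverse_word:
  assumes "valid w"
  obtains u where "valid u" "\<And>x. run_facet u (run_facet w x) = x"
    "\<And>x. run_facet w (run_facet u x) = x"
proof -
  have "\<exists>u. valid u \<and> (\<forall>x. run_facet u (run_facet w x) = x) \<and> (\<forall>x. run_facet w (run_facet u x) = x)"
    using assms
  proof (induction w)
    case (Cons m w)
    obtain e v where m: "m = (e, v)" by (cases m)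
    obtain u where u: "valid u" "\<And>x. run_facet u (run_facet w x) = x"
        "\<And>x. run_facet w (run_facet u x) = x"
      using Cons by auto
    have "e \<in> axes" using Cons.prems by (auto simp: m)
    then show ?case
      using u Cons.prems
      by (intro exI[of _ "u @ [m, m, m]"]) (auto simp: m slice_facet_order_4)
  qed (auto intro!: exI[of _ "[]"])
  with that show thesis by blast
qed

lemma inverse_word_piece:
  assumes "\<And>x. run_facet u (run_facet w x) = x"
  shows "run_piece u (run_piece w c) = c"
  using arg_cong[OF assms[of "(c, 0)"], of fst] by simp


section \<open>Facets, chirality and twist\<close>

definition cubic :: "vec \<Rightarrow> vec" where
  "cubic = (\<lambda>(a, b, c). (a ^ 3, b ^ 3, c ^ 3))"

text \<open>
  This is the determinant of the vectors \<open>n\<close>, \<open>c\<close> and \<open>cubic c\<close>. Quarter turns about the axes commute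
  with the odd function \<open>cubic\<close>, hence preserve it. For an edge \<open>c = 3 n + 3 m + d\<close> with unit
  coordinate vectors \<open>n\<close>, \<open>m\<close>, \<open>d\<close> up to sign it equals \<open>-24\<close> times the determinant of
  \<open>n\<close>, \<open>m\<close>, \<open>d\<close>, which changes sign when \<open>n\<close> and \<open>m\<close> are exchanged.
\<close>

definition chirality :: "vec \<times> vec \<Rightarrow> int" where
  "chirality = (\<lambda>(c, n). dot n (cross c (cubic c)))"

text \<open>
  The number of spins that lead to a corner facet from the facet of its cubie orthogonal to the
  third axis, which serves as base point.
\<close>

definition twist_index :: "vec \<times> vec \<Rightarrow> nat" where
  "twist_index = (\<lambda>(c, n). if snd (snd n) \<noteq> 0 then 0
     else if snd (snd (third_turn (- c) n)) \<noteq> 0 then 2 else 1)"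

definition base_facet :: "vec \<Rightarrow> vec \<times> vec" where
  "base_facet = (\<lambda>(a, b, c). ((a, b, c), (0, 0, c div 3)))"

definition corner_facets :: "(vec \<times> vec) set" where
  "corner_facets = {x \<in> geom_facets. fst x \<in> corner_cubies}"

definition edge_facets :: "(vec \<times> vec) set" where
  "edge_facets = {x \<in> geom_facets. fst x \<in> edge_cubies}"

text \<open>
  The generator of the action of the cyclic group of order 3 on corner facets.
\<close>

definition spin :: "vec \<times> vec \<Rightarrow> vec \<times> vec" where
  "spin = (\<lambda>(c, n). (c, third_turn (- c) n))"

lemma quarter_turn_simps [simp]:
  "quarter_turn (1, 0, 0) (a, b, c) = (a, - c, b)"
  "quarter_turn (0, 1, 0) (a, b, c) = (c, b, - a)"
  "quarter_turn (0, 0, 1) (a, b, c) = (- b, a, c)"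
  by (simp_all add: quarter_turn_def)

lemma slice_piece_cubies:
  assumes "e \<in> axes"
  shows "slice_piece e v c \<in> cubies \<longleftrightarrow> c \<in> cubies"
    and "extremal_coords (slice_piece e v c) = extremal_coords c"
proof -
  have neg: "- x = 3 \<longleftrightarrow> x = -3" "- x = 1 \<longleftrightarrow> x = -1" for x :: int by auto
  obtain x y z where c: "c = (x, y, z)" by (cases c)
  have ext: "extremal_coords (quarter_turn e c) = extremal_coords c"
    using assms unfolding axes_def c insert_iff empty_iff
    by (elim disjE FalseE) (simp_all add: neg)
  define S where "S = slices"
  have neg_S: "- x \<in> S \<longleftrightarrow> x \<in> S" for x by (auto simp: S_def)
  have in_S: "quarter_turn e c \<in> S \<times> S \<times> S \<longleftrightarrow> c \<in> S \<times> S \<times> S"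
    using assms unfolding axes_def c insert_iff empty_iff
    by (elim disjE FalseE) (simp_all add: neg_S conj_ac)
  have cubies: "cubies = {c \<in> S \<times> S \<times> S. extremal_coords c \<ge> 1}"
    unfolding cubies_def S_def ..
  show "slice_piece e v c \<in> cubies \<longleftrightarrow> c \<in> cubies"
    and "extremal_coords (slice_piece e v c) = extremal_coords c"
    unfolding slice_piece_def cubies mem_Collect_eq using ext in_S by auto
qed

lemma quarter_turn_normals: "e \<in> axes \<Longrightarrow> n \<in> normals \<Longrightarrow> quarter_turn e n \<in> normals"
  by (auto simp: axes_def normals_def quarter_turn_def)

lemma slice_geom_facets:
  assumes "e \<in> axes" "x \<in> geom_facets"
  shows "slice_facet e v x \<in> geom_facets"
proof -
  obtain c n where x: "x = (c, n)" by (cases x)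
  have "dot (quarter_turn e c) (quarter_turn e n) = dot c n"
    using assms(1) by (cases c; cases n) (auto simp: axes_def quarter_turn_def)
  with assms slice_piece_cubies(1)[OF assms(1), of v c] quarter_turn_normals[OF assms(1), of n]
  show ?thesis by (auto simp: x geom_facets_def slice_facet_def slice_piece_def split: if_splits)
qed

lemma slice_chirality:
  assumes "e \<in> axes"
  shows "chirality (slice_facet e v x) = chirality x"
proof -
  obtain a b c a' b' c' where "x = ((a, b, c), (a', b', c'))" by (metis prod.exhaust)
  with assms show ?thesis
    by (auto simp: axes_def slice_facet_def quarter_turn_def chirality_def cubic_def algebra_simps)
qed


section \<open>Explicit words and their effects\<close>

abbreviation "swap \<equiv> Transposition.transpose"

definition cubie_list :: "nat \<Rightarrow> vec list" where
  "cubie_list k = filter (\<lambda>c. extremal_coords c = k)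
     (List.product [-3, -1, 1, 3] (List.product [-3, -1, 1, 3] [-3, -1, 1, 3]))"

lemma cubie_list:
  "edge_cubies = set (cubie_list 2)" "corner_cubies = set (cubie_list 3)"
  "CentGeom = set (cubie_list 1)"
  by (auto simp only: edge_cubies_def corner_cubies_def CentGeom_def cubies_def cubie_list_def
       set_filter set_product mem_Collect_eq list.set)

lemma corner_facets_by_spinning:
  "\<forall>c\<in>corner_cubies. \<forall>n\<in>normals. dot c n = 3 \<longrightarrow>
       (let x = (c, n) in x = (spin ^^ twist_index x) (base_facet c) \<and>
       spin (spin (spin x)) = x \<and> snd (spin x) \<in> normals \<and> dot c (snd (spin x)) = 3
       \<and> twist_index (spin x) = (twist_index x + 1) mod 3)"
  by code_simp

lemma base_facet_on_cubie:
  "\<forall>c\<in>corner_cubies. snd (base_facet c) \<in> normals \<and> dot c (snd (base_facet c)) = 3 \<and> twist_index (base_facet c) = 0"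
  by code_simp

lemma slice_commutes_with_spin:
  "\<forall>e\<in>axes. \<forall>v\<in>slices. \<forall>c\<in>corner_cubies. \<forall>n\<in>normals. dot c n = 3 \<longrightarrow>
    slice_facet e v (spin (c, n)) = spin (slice_facet e v (c, n))"
  by code_simp

text \<open>
  An outer slice orthogonal to the third axis maps base facets to base facets. Any other outer slice
  moves four corners and twists two of them in one direction and two in the other.
\<close>

lemma slice_untwisted:
  "\<forall>e\<in>axes. \<forall>v\<in>slices.
    (\<Sum>c\<in>corner_cubies. twist_index (slice_facet e v (base_facet c))) mod 3 = 0"
  by code_simp

lemma edge_has_opposite_chiralities:
  "\<forall>c\<in>edge_cubies. \<exists>n\<in>normals. \<exists>m\<in>normals. n \<noteq> m \<and> {a\<in>normals. dot c a = 3} = {n, m} \<and>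
     chirality (c, n) = 24 \<and> chirality (c, m) = -24"
  by code_simp

text \<open>
  The first two words are commutators of a slice move and a conjugate of another one, chosen so that
  the two supports share a single edge or a single centre.
\<close>

definition edge_cycle :: word where
  "edge_cycle = X (-3) 3 @ Y 3 1 @ X 1 2 @ Y 3 3 @ X (-3) 1 @ Y 3 1 @ X 1 2 @ Y 3 3"

definition centre_cycle :: word where
  "centre_cycle = Z 3 1 @ X (-1) 3 @ Z 1 2 @ X (-1) 1 @ Z 3 3 @ X (-1) 3 @ Z 1 2 @ X (-1) 1"

definition corner_swap :: word where
  "corner_swap = Z 3 2 @ Y 3 3 @ X 3 2 @ Z 3 1 @ Y 3 2 @ X 3 1"

definition corner_twist :: word where
  "corner_twist = Y 3 1 @ X 3 3 @ Z 3 2 @ X 3 1 @ Z 3 2 @ X 3 3 @ Y 3 1 @ X 3 2 @ Y 3 3 @ Z 3 2"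

lemma edge_cycle_effect:
  "map (run_piece edge_cycle) (cubie_list 2) =
     map (swap (-3,-1,-3) (-3,3,-1) \<circ> swap (-3,-1,-3) (1,-3,3)) (cubie_list 2)"
  "map (run_piece edge_cycle) (cubie_list 1) = cubie_list 1"
  "map (run_facet edge_cycle) (map base_facet (cubie_list 3)) = map base_facet (cubie_list 3)"
  "valid edge_cycle"
  by code_simp+

lemma centre_cycle_effect:
  "map (run_piece centre_cycle) (cubie_list 1) =
     map (swap (-1,-1,3) (-1,1,3) \<circ> swap (-1,-1,3) (1,3,1)) (cubie_list 1)"
  "map (run_piece centre_cycle) (cubie_list 2) = cubie_list 2"
  "map (run_facet centre_cycle) (map base_facet (cubie_list 3)) = map base_facet (cubie_list 3)"
  "valid centre_cycle"
  by code_simp+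

lemma corner_swap_effect:
  "map (run_piece corner_swap) (cubie_list 3) = map (swap (3,-3,-3) (3,3,3)) (cubie_list 3)"
  "valid corner_swap"
  by code_simp+

lemma corner_twist_effect:
  "map (run_facet corner_twist) (map base_facet (cubie_list 3)) =
     map (\<lambda>x. if fst x = (3,3,3) then spin x else if fst x = (3,-3,-3) then spin (spin x) else x)
      (map base_facet (cubie_list 3))"
  "valid corner_twist"
  by code_simp+

text \<open>
  Moving the cycle of \<open>edge_cycle\<close> by these words gives all three-cycles through two fixed edges.
\<close>

lemma edge_setups:
  "\<forall>c\<in>edge_cubies - {(-3,-1,-3), (-3,3,-1)}.
    \<exists>w. valid w \<and> run_piece w (-3,-1,-3) = (-3,-1,-3)
      \<and> run_piece w (-3,3,-1) = (-3,3,-1) \<and> run_piece w (1,-3,3) = c"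
proof -
  have "\<forall>c\<in>edge_cubies - {(-3,-1,-3), (-3,3,-1)}. \<exists>w\<in>set [
      Y (-3) 1 @ X 1 1, Y (-3) 3, Z 3 3, Y 1 2 @ Z 3 1,
      Z 3 1 @ X 1 3, Z 1 3 @ Y (-3) 3, Y (-3) 2, Y (-3) 2 @ X 1 1,
      X (-1) 1 @ Y (-3) 2, Z 3 2, X 1 1, [],
      X 1 2, X 1 3, Y (-3) 1, Y (-3) 3 @ X 1 1,
      X 3 2 @ Z 3 1, Z 3 3 @ X 1 3, X 3 1 @ Y (-3) 1, Z 3 1,
      X 3 3 @ Z 3 1, X 3 2 @ Y (-3) 1]. valid w \<and> run_piece w (-3,-1,-3) = (-3,-1,-3)
   \<and> run_piece w (-3,3,-1) = (-3,3,-1) \<and> run_piece w (1,-3,3) = c"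
    by code_simp
  then show ?thesis by blast
qed

lemma centre_setups:
  "\<forall>c\<in>CentGeom - {(-1,-1,3), (-1,1,3)}.
    \<exists>w. valid w \<and> run_piece w (-1,-1,3) = (-1,-1,3)
      \<and> run_piece w (-1,1,3) = (-1,1,3) \<and> run_piece w (1,3,1) = c"
proof -
  have "\<forall>c\<in>CentGeom - {(-1,-1,3), (-1,1,3)}. \<exists>w\<in>set [
      Z (-1) 3 @ X 1 2, Z 1 1 @ Y 3 3, Z (-1) 1 @ Y 3 1, Z 1 1,
      Y (-3) 1 @ X 1 2, Z 1 2, Z (-3) 2 @ X 1 3, Z (-3) 1 @ X 1 3,
      Y 3 2, Y 3 3, X 1 2, Y (-3) 3 @ X 1 2,
      Z (-3) 3 @ X 1 3, X 1 1, X 1 3, X 1 1 @ Y 3 1,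
      Y 3 1, [], Z (-1) 3 @ Y 3 1, Z 1 3,
      Z (-1) 1 @ X 1 2, Z 1 3 @ Y 3 3]. valid w \<and> run_piece w (-1,-1,3) = (-1,-1,3)
   \<and> run_piece w (-1,1,3) = (-1,1,3) \<and> run_piece w (1,3,1) = c"
    by code_simp
  then show ?thesis by blast
qed

lemma corner_setups:
  "\<forall>c\<in>corner_cubies - {(3,-3,-3)}.
    \<exists>w. valid w \<and> run_piece w (3,-3,-3) = (3,-3,-3)
      \<and> run_piece w (3,3,3) = c"
proof -
  have "\<forall>c\<in>corner_cubies - {(3,-3,-3)}. \<exists>w\<in>set [
      X (-3) 3 @ Y 3 2, Z 3 2, Y 3 2, Y 3 3,
      Z 3 3, Y 3 1, []]. valid w \<and> run_piece w (3,-3,-3) = (3,-3,-3)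
   \<and> run_piece w (3,3,3) = c"
    by code_simp
  then show ?thesis by blast
qed


section \<open>Permutations of pieces realized by words\<close>

lemma run_piece_kind:
  assumes "valid w"
  shows "c \<in> edge_cubies \<Longrightarrow> run_piece w c \<in> edge_cubies"
    and "c \<in> corner_cubies \<Longrightarrow> run_piece w c \<in> corner_cubies"
    and "c \<in> CentGeom \<Longrightarrow> run_piece w c \<in> CentGeom"
  using assms
  by (induction w)
    (auto simp: edge_cubies_def corner_cubies_def CentGeom_def slice_piece_cubies)

lemma run_facet_kind:
  assumes "valid w"
  shows "x \<in> geom_facets \<Longrightarrow> run_facet w x \<in> geom_facets"
    and "x \<in> corner_facets \<Longrightarrow> run_facet w x \<in> corner_facets"
    and "x \<in> edge_facets \<Longrightarrow> run_facet w x \<in> edge_facets"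
proof -
  show *: "run_facet w x \<in> geom_facets" if "x \<in> geom_facets" for x
    using assms that by (induction w) (auto simp: slice_geom_facets)
  show "x \<in> corner_facets \<Longrightarrow> run_facet w x \<in> corner_facets"
    and "x \<in> edge_facets \<Longrightarrow> run_facet w x \<in> edge_facets"
    using * run_piece_kind[OF assms] by (auto simp: corner_facets_def edge_facets_def)
qed

lemma run_chirality: "valid w \<Longrightarrow> chirality (run_facet w x) = chirality x"
  by (induction w) (auto simp: slice_chirality)

text \<open>
  The pieces in \<open>M\<close> and the facets in \<open>N\<close> are the ones that the realizing word leaves in place.
\<close>

definition realized :: "vec set \<Rightarrow> (vec \<times> vec) set \<Rightarrow> vec set \<Rightarrow> (vec \<Rightarrow> vec) set" where
  "realized M N S = {p. \<exists>w. valid w \<and> (\<forall>c\<in>M. run_piece w c = c) \<and> (\<forall>x\<in>N. run_facet w x = x) \<and>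
     (\<forall>c\<in>S. run_piece w c = p c)}"

definition invariant :: "vec set \<Rightarrow> bool" where
  "invariant S \<longleftrightarrow> (\<forall>w. valid w \<longrightarrow> run_piece w ` S \<subseteq> S)"

definition invariant_facets :: "(vec \<times> vec) set \<Rightarrow> bool" where
  "invariant_facets N \<longleftrightarrow> (\<forall>w. valid w \<longrightarrow> run_facet w ` N \<subseteq> N)"

lemma invariants [simp]:
  "invariant edge_cubies" "invariant corner_cubies" "invariant CentGeom" "invariant {}"
  "invariant_facets corner_facets" "invariant_facets {}"
  by (auto simp: invariant_def invariant_facets_def run_piece_kind run_facet_kind
      intro: run_piece_kind run_facet_kind)

lemma realized_id: "id \<in> realized M N S"
  unfolding realized_def by (auto intro!: exI[of _ "[]"])

lemma realized_comp:
  assumes "invariant S" "p \<in> realized M N S" "q \<in> realized M N S"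
  shows "p \<circ> q \<in> realized M N S"
proof -
  obtain u where u: "valid u" "\<forall>c\<in>M. run_piece u c = c" "\<forall>x\<in>N. run_facet u x = x"
    "\<forall>c\<in>S. run_piece u c = p c" using assms(2) by (auto simp: realized_def)
  obtain w where w: "valid w" "\<forall>c\<in>M. run_piece w c = c" "\<forall>x\<in>N. run_facet w x = x"
    "\<forall>c\<in>S. run_piece w c = q c" using assms(3) by (auto simp: realized_def)
  have "q c \<in> S" if "c \<in> S" for c
    using assms(1) w(1,4) that by (force simp: invariant_def)
  with u w show ?thesis
    unfolding realized_def by (auto intro!: exI[of _ "u @ w"])
qed

lemma realized_conj:
  assumes "invariant S" "invariant M" "invariant_facets N" "valid g"
    and p: "p \<in> realized M N S"
    and q: "\<And>c. c \<in> S \<Longrightarrow> q (run_piece g c) = run_piece g (p c)"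
  shows "q \<in> realized M N S"
proof -
  obtain w where w: "valid w" "\<forall>c\<in>M. run_piece w c = c" "\<forall>x\<in>N. run_facet w x = x"
    "\<forall>c\<in>S. run_piece w c = p c" using p by (auto simp: realized_def)
  obtain u where u: "valid u" "\<And>x. run_facet u (run_facet g x) = x"
    "\<And>x. run_facet g (run_facet u x) = x"
    using inverse_word[OF assms(4)] by metis
  have gu: "run_piece g (run_piece u c) = c" for c
    by (rule inverse_word_piece) (rule u(3))
  have "run_piece u c \<in> S" if "c \<in> S" for c
    using that assms(1) u(1) by (auto simp: invariant_def)
  moreover have "run_piece u c \<in> M" if "c \<in> M" for c
    using that assms(2) u(1) by (auto simp: invariant_def)
  moreover have "run_facet u x \<in> N" if "x \<in> N" for x
    using that assms(3) u(1) by (auto simp: invariant_facets_def)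
  moreover have "run_piece g (p (run_piece u c)) = q c" if "c \<in> S" for c
    using q[of "run_piece u c"] calculation(1)[OF that] by (simp add: gu)
  ultimately show ?thesis
    unfolding realized_def mem_Collect_eq using u w assms(4)
    by (intro exI[of _ "g @ w @ u"]) (auto simp: gu)
qed

lemma run_piece_inj: "valid g \<Longrightarrow> run_piece g c = run_piece g d \<longleftrightarrow> c = d"
  by (metis inverse_word inverse_word_piece)

lemma run_piece_swap:
  "valid g \<Longrightarrow> swap (run_piece g a) (run_piece g b) (run_piece g c) = run_piece g (swap a b c)"
  by (auto simp: Transposition.transpose_def run_piece_inj)

text \<open>
  Since \<open>(x y) = (a x) (a y) (a x)\<close>, and \<open>(a b) (a b)\<close> can be inserted between these factors, such a
  product decomposes into three-cycles through \<open>a\<close> and \<open>b\<close>. The inverse of a three-cycle is its square,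
  so closure under composition is enough.
\<close>

lemma double_swaps:
  assumes comp: "\<And>p q. p \<in> K \<Longrightarrow> q \<in> K \<Longrightarrow> p \<circ> q \<in> K" and id: "id \<in> K"
    and ab: "a \<noteq> b"
    and cycle: "\<And>x. x \<in> S \<Longrightarrow> x \<noteq> a \<Longrightarrow> x \<noteq> b \<Longrightarrow> swap a b \<circ> swap a x \<in> K"
    and "x \<in> S" "y \<in> S" "x \<noteq> y"
  shows "swap a b \<circ> swap x y \<in> K" "swap x y \<circ> swap a b \<in> K"
proof -
  have A: "swap a b \<circ> swap a z \<in> K" if "z \<in> S" "z \<noteq> a" for z
    using cycle[OF that] id by (cases "z = b") auto
  have B: "swap a z \<circ> swap a b \<in> K" if "z \<in> S" "z \<noteq> a" for z
  proof (cases "z = b")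
    case False
    have "swap a z \<circ> swap a b = (swap a b \<circ> swap a z) \<circ> (swap a b \<circ> swap a z)"
      using that ab False by (auto simp: fun_eq_iff Transposition.transpose_def)
    with comp A that show ?thesis by simp
  qed (use id in auto)
  have xy: "swap x y = swap a x \<circ> swap a y \<circ> swap a x" if "x \<noteq> a" "y \<noteq> a"
    using that \<open>x \<noteq> y\<close> by (auto simp: fun_eq_iff Transposition.transpose_def)
  have abab: "swap a b \<circ> (swap a b \<circ> f) = f" for f :: "'a \<Rightarrow> 'a"
    by (auto simp: fun_eq_iff)
  show "swap a b \<circ> swap x y \<in> K"
  proof (cases "x = a \<or> y = a")
    case True
    with A[of x] A[of y] assms(5-) show ?thesis
      by (auto simp: Transposition.transpose_commute)
  next
    case False
    then have "swap a b \<circ> swap x y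
      = (swap a b \<circ> swap a x) \<circ> ((swap a y \<circ> swap a b) \<circ> (swap a b \<circ> swap a x))"
      unfolding xy[OF False[simplified, THEN conjunct1] False[simplified, THEN conjunct2]]
      by (simp add: o_assoc[symmetric] abab)
    with A B comp False assms(5-) show ?thesis by simp
  qed
  show "swap x y \<circ> swap a b \<in> K"
  proof (cases "x = a \<or> y = a")
    case True
    with B[of x] B[of y] assms(5-) show ?thesis
      by (auto simp: Transposition.transpose_commute)
  next
    case False
    then have "swap x y \<circ> swap a b
      = (swap a x \<circ> swap a b) \<circ> ((swap a b \<circ> swap a y) \<circ> (swap a x \<circ> swap a b))"
      unfolding xy[OF False[simplified, THEN conjunct1] False[simplified, THEN conjunct2]]
      by (simp add: o_assoc[symmetric] abab)
    with A B comp False assms(5-) show ?thesis by simp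
  qed
qed

text \<open>
  The dichotomy is the parity of \<open>p\<close>, found by induction on a product of transpositions instead of
  through the sign.
\<close>

lemma permutes_up_to_swap:
  assumes comp: "\<And>p q. p \<in> K \<Longrightarrow> q \<in> K \<Longrightarrow> p \<circ> q \<in> K" and id: "id \<in> K"
    and ab: "a \<noteq> b"
    and cycle: "\<And>x. x \<in> S \<Longrightarrow> x \<noteq> a \<Longrightarrow> x \<noteq> b \<Longrightarrow> swap a b \<circ> swap a x \<in> K"
    and "finite S" "p permutes S"
  shows "p \<in> K \<or> swap a b \<circ> p \<in> K"
  using assms(6,5)
proof (induction rule: permutes_induct)
  case (swap x y p)
  have *: "swap a b \<circ> swap x y \<in> K" "swap x y \<circ> swap a b \<in> K"
    using double_swaps[of K a b S x y] comp id ab cycle swap by blast+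
  from swap.IH show ?case
  proof
    assume "p \<in> K"
    with comp[OF *(1)] have "swap a b \<circ> (swap x y \<circ> p) \<in> K"
      by (simp only: o_assoc)
    then show ?thesis ..
  next
    assume "swap a b \<circ> p \<in> K"
    with comp[OF *(2)] have "swap x y \<circ> swap a b \<circ> (swap a b \<circ> p) \<in> K" .
    also have "swap x y \<circ> swap a b \<circ> (swap a b \<circ> p) = swap x y \<circ> p"
      by (auto simp: fun_eq_iff)
    finally show ?thesis ..
  qed
next
  case id
  show ?case using assms(2) by (rule disjI1)
qed

lemma finite_cubies [simp]: "finite edge_cubies" "finite corner_cubies" "finite CentGeom"
  by (simp_all add: cubie_list)


section \<open>The total twist of the corners\<close>

lemma base_facet_fst [simp]: "fst (base_facet c) = c"
  by (auto simp: base_facet_def split: prod.splits)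

lemma base_facet_corner:
  assumes "c \<in> corner_cubies"
  shows "base_facet c \<in> corner_facets" "twist_index (base_facet c) = 0"
proof -
  have "base_facet c = (c, snd (base_facet c))"
    by (simp add: prod_eq_iff)
  moreover have *: "snd (base_facet c) \<in> normals" "dot c (snd (base_facet c)) = 3"
    "twist_index (base_facet c) = 0"
    using base_facet_on_cubie assms by blast+
  moreover have "c \<in> cubies" using assms by (simp add: corner_cubies_def)
  ultimately show "base_facet c \<in> corner_facets" "twist_index (base_facet c) = 0"
    using assms unfolding corner_facets_def geom_facets_def
    by (metis (mono_tags, lifting) case_prodI fst_conv mem_Collect_eq)+
qed

lemma spin_corner:
  assumes "x \<in> corner_facets"
  shows "x = (spin ^^ twist_index x) (base_facet (fst x))" "spin (spin (spin x)) = x"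
    "spin x \<in> corner_facets" "twist_index (spin x) = (twist_index x + 1) mod 3"
proof -
  obtain c n where x: "x = (c, n)" by (cases x)
  have cn: "c \<in> corner_cubies" "n \<in> normals" "dot c n = 3"
    using assms by (auto simp: x corner_facets_def geom_facets_def)
  have *: "(let x = (c, n) in x = (spin ^^ twist_index x) (base_facet c) \<and>
       spin (spin (spin x)) = x \<and> snd (spin x) \<in> normals \<and> dot c (snd (spin x)) = 3
       \<and> twist_index (spin x) = (twist_index x + 1) mod 3)"
    using corner_facets_by_spinning cn by blast
  then show "x = (spin ^^ twist_index x) (base_facet (fst x))" "spin (spin (spin x)) = x"
    "twist_index (spin x) = (twist_index x + 1) mod 3"
    by (auto simp: Let_def x)
  have "fst (spin x) = c" by (simp add: spin_def x)
  with * cn show "spin x \<in> corner_facets"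
    by (auto simp: corner_facets_def geom_facets_def corner_cubies_def x Let_def split: prod.splits)
qed

lemma fst_spin [simp]: "fst (spin x) = fst x"
  by (auto simp: spin_def split: prod.splits)

lemma fst_spin_power [simp]: "fst ((spin ^^ k) x) = fst x"
  by (induction k) auto

lemma spin_power_corner: "x \<in> corner_facets \<Longrightarrow> (spin ^^ k) x \<in> corner_facets"
  by (induction k) (auto simp: spin_corner)

lemma corner_facets_fst: "x \<in> corner_facets \<Longrightarrow> fst x \<in> corner_cubies"
  by (auto simp: corner_facets_def)

lemma twist_index_power:
  "x \<in> corner_facets \<Longrightarrow> twist_index ((spin ^^ k) x) mod 3 = (twist_index x + k) mod 3"
proof (induction k)
  case (Suc k)
  then have "twist_index ((spin ^^ Suc k) x) mod 3 = (twist_index ((spin ^^ k) x) + 1) mod 3"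
    by (simp add: spin_corner spin_power_corner)
  also have "\<dots> = (twist_index ((spin ^^ k) x) mod 3 + 1) mod 3"
    by (rule mod_add_left_eq[symmetric])
  also have "\<dots> = ((twist_index x + k) mod 3 + 1) mod 3"
    using Suc by (simp only:)
  also have "\<dots> = (twist_index x + k + 1) mod 3"
    by (rule mod_add_left_eq)
  also have "\<dots> = (twist_index x + Suc k) mod 3"
    by simp
  finally show ?case .
qed simp

lemma slice_spin:
  assumes "e \<in> axes" "v \<in> slices" "x \<in> corner_facets"
  shows "slice_facet e v (spin x) = spin (slice_facet e v x)"
proof -
  obtain c n where x: "x = (c, n)" by (cases x)
  show ?thesis
    using slice_commutes_with_spin assms unfolding x
    by (auto simp: corner_facets_def geom_facets_def simp del: insert_iff)
qed

text \<open>
  The facet part of an automorphism of the corner bundle, as a function whose values outside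
  \<open>corner_facets\<close> are arbitrary; slice moves are then directly of this kind.
\<close>

definition corner_map :: "(vec \<times> vec \<Rightarrow> vec \<times> vec) \<Rightarrow> bool" where
  "corner_map b \<longleftrightarrow> b ` corner_facets \<subseteq> corner_facets \<and> (\<forall>x\<in>corner_facets. b (spin x) = spin (b x)) \<and>
     (\<exists>p. bij_betw p corner_cubies corner_cubies \<and> (\<forall>x\<in>corner_facets. fst (b x) = p (fst x)))"

definition twist :: "(vec \<times> vec \<Rightarrow> vec \<times> vec) \<Rightarrow> nat" where
  "twist b = (\<Sum>c\<in>corner_cubies. twist_index (b (base_facet c)))"

lemma corner_map_power:
  assumes "corner_map b" "x \<in> corner_facets"
  shows "b ((spin ^^ k) x) = (spin ^^ k) (b x)"
  using assms by (induction k) (auto simp: corner_map_def spin_power_corner)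

lemma corner_map_eqI:
  assumes "corner_map b" "corner_map b'"
    and "\<And>c. c \<in> corner_cubies \<Longrightarrow> b (base_facet c) = b' (base_facet c)"
    and "x \<in> corner_facets"
  shows "b x = b' x"
  using assms spin_corner(1)[OF assms(4)] corner_facets_fst[OF assms(4)]
  by (metis base_facet_corner(1) corner_map_power)

text \<open>
  The total twist is additive because reindexing the corners by the permutation that \<open>b\<close> induces does
  not change a sum over all corners.
\<close>

lemma corner_map_comp:
  assumes "corner_map a" "corner_map b"
  shows "corner_map (a \<circ> b)" "twist (a \<circ> b) mod 3 = (twist a + twist b) mod 3"
proof -
  obtain q where q: "bij_betw q corner_cubies corner_cubies" "\<forall>x\<in>corner_facets. fst (b x) = q (fst x)"
    using assms(2) by (auto simp: corner_map_def)
  obtain p where p: "bij_betw p corner_cubies corner_cubies" "\<forall>x\<in>corner_facets. fst (a x) = p (fst x)"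
    using assms(1) by (auto simp: corner_map_def)
  have b: "b x \<in> corner_facets" if "x \<in> corner_facets" for x
    using that assms(2) by (auto simp: corner_map_def)
  have a: "a x \<in> corner_facets" if "x \<in> corner_facets" for x
    using that assms(1) by (auto simp: corner_map_def)
  show "corner_map (a \<circ> b)"
    using assms q p b a unfolding corner_map_def
    by (auto intro!: exI[of _ "p \<circ> q"] bij_betw_trans)
  have *: "twist_index (a (b (base_facet c))) mod 3
      = (twist_index (a (base_facet (q c))) + twist_index (b (base_facet c))) mod 3"
    if c: "c \<in> corner_cubies" for c
  proof -
    have x: "b (base_facet c) \<in> corner_facets" "fst (b (base_facet c)) = q c"
      using c q(2) b base_facet_corner by auto
    have "q c \<in> corner_cubies" using q(1) c by (auto simp: bij_betw_def)
    then have qc: "base_facet (q c) \<in> corner_facets" by (rule base_facet_corner)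
    have "a (b (base_facet c)) = (spin ^^ twist_index (b (base_facet c))) (a (base_facet (q c)))"
      using spin_corner(1)[OF x(1)] corner_map_power[OF assms(1) qc] x(2) by metis
    then show ?thesis using twist_index_power[OF a[OF qc]] by metis
  qed
  have "twist (a \<circ> b) mod 3
      = (\<Sum>c\<in>corner_cubies. twist_index (a (base_facet (q c))) + twist_index (b (base_facet c))) mod 3"
    unfolding twist_def comp_def
    by (subst (1 2) mod_sum_eq[symmetric]) (simp only: * cong: sum.cong)
  also have "(\<Sum>c\<in>corner_cubies. twist_index (a (base_facet (q c)))) = twist a"
    unfolding twist_def by (rule sum.reindex_bij_betw[OF q(1)])
  then have "(\<Sum>c\<in>corner_cubies. twist_index (a (base_facet (q c))) + twist_index (b (base_facet c)))
    = twist a + twist b"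
    by (simp add: sum.distrib twist_def)
  finally show "twist (a \<circ> b) mod 3 = (twist a + twist b) mod 3" .
qed

lemma run_piece_bij:
  assumes "valid w" "invariant S"
  shows "bij_betw (run_piece w) S S"
proof -
  obtain u where u: "valid u" "\<And>x. run_facet u (run_facet w x) = x"
    "\<And>x. run_facet w (run_facet u x) = x"
    using inverse_word[OF assms(1)] by metis
  show ?thesis
  proof (rule bij_betwI[where g = "run_piece u"])
    show "run_piece w \<in> S \<rightarrow> S" "run_piece u \<in> S \<rightarrow> S"
      using assms u(1) unfolding invariant_def by blast+
  qed (rule inverse_word_piece, rule u)+
qed

lemma corner_map_run:
  assumes "valid w"
  shows "corner_map (run_facet w)" "twist (run_facet w) mod 3 = 0"
proof -
  have slice_map: "corner_map (slice_facet e v) \<and> twist (slice_facet e v) mod 3 = 0"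
    if "e \<in> axes" "v \<in> slices" for e v
  proof
    have "valid [(e, v)]" using that by simp
    moreover have "run_piece [(e, v)] = slice_piece e v" by auto
    ultimately have "bij_betw (slice_piece e v) corner_cubies corner_cubies"
      "\<And>x. x \<in> corner_facets \<Longrightarrow> slice_facet e v x \<in> corner_facets"
      using run_piece_bij[of "[(e, v)]" corner_cubies] run_facet_kind(2)[of "[(e, v)]"]
      by (simp_all del: valid_simps)
    then show "corner_map (slice_facet e v)"
      using that by (auto simp: corner_map_def slice_spin simp del: insert_iff intro!: exI[of _ "slice_piece e v"])
    show "twist (slice_facet e v) mod 3 = 0"
      using slice_untwisted that by (auto simp: twist_def simp del: insert_iff)
  qed
  have "corner_map (run_facet w) \<and> twist (run_facet w) mod 3 = 0"
    using assms
  proof (induction rule: run_facet_induct)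
    case id
    have "bij_betw id corner_cubies corner_cubies" by simp
    then have "corner_map id" by (auto simp: corner_map_def intro!: exI[of _ id])
    moreover have "twist id = 0" by (simp add: twist_def base_facet_corner)
    ultimately show ?case by (simp only: mod_0)
  next
    case (slice e v f)
    have sl: "corner_map (slice_facet e v)" "twist (slice_facet e v) mod 3 = 0"
      using slice_map[OF slice(1,2)] by blast+
    then show ?case
      using corner_map_comp[of "slice_facet e v" f] slice(3) by (metis add_0 mod_0 mod_add_eq)
  qed
  then show "corner_map (run_facet w)" "twist (run_facet w) mod 3 = 0" by blast+
qed


section \<open>Words that move the pieces of one kind\<close>

lemma run_corner_facets_fixed:
  assumes "valid w" "map (run_facet w) (map base_facet (cubie_list 3)) = map base_facet (cubie_list 3)"
  shows "\<forall>x\<in>corner_facets. run_facet w x = x"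
proof
  fix x assume x: "x \<in> corner_facets"
  have "run_facet w (base_facet c) = id (base_facet c)" if "c \<in> corner_cubies" for c
    using assms(2) that by (auto simp: cubie_list)
  then have "run_facet w x = id x"
    using corner_map_eqI[OF corner_map_run(1)[OF assms(1)] _ _ x, of id] corner_map_run(1)[of "[]"]
    by (simp add: corner_map_def)
  then show "run_facet w x = x" by simp
qed

text \<open>
  A conjugate of a three-cycle \<open>(a b) (a x)\<close> by a word that fixes \<open>a\<close> and \<open>b\<close> and takes \<open>x\<close> to \<open>y\<close> is
  \<open>(a b) (a y)\<close>.
\<close>

lemma realized_three_cycles:
  assumes S: "invariant S" "invariant M" "invariant_facets N" "a \<in> S" "b \<in> S" "x \<in> S"
    and base: "swap a b \<circ> swap a x \<in> realized M N S"
    and setups: "\<forall>c\<in>S - {a, b}. \<exists>w. valid w \<and> run_piece w a = a \<and> run_piece w b = b \<and> run_piece w x = c"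
    and "y \<in> S" "y \<noteq> a" "y \<noteq> b"
  shows "swap a b \<circ> swap a y \<in> realized M N S"
proof -
  obtain g where g: "valid g" "run_piece g a = a" "run_piece g b = b" "run_piece g x = y"
    using setups assms by auto
  show ?thesis
    by (rule realized_conj[OF S(1-3) g(1) base])
      (use run_piece_swap[OF g(1)] g in \<open>metis comp_apply\<close>)
qed

lemma edge_cycles_realized:
  assumes "y \<in> edge_cubies" "y \<noteq> (-3,-1,-3)" "y \<noteq> (-3,3,-1)"
  shows "swap (-3,-1,-3) (-3,3,-1) \<circ> swap (-3,-1,-3) y \<in> realized CentGeom corner_facets edge_cubies"
proof (rule realized_three_cycles[where x = "(1,-3,3)"])
  show "swap (-3,-1,-3) (-3,3,-1) \<circ> swap (-3,-1,-3) (1,-3,3)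
    \<in> realized CentGeom corner_facets edge_cubies"
    unfolding realized_def mem_Collect_eq
    by (rule exI[of _ edge_cycle])
      (use edge_cycle_effect run_corner_facets_fixed[of edge_cycle] in
        \<open>auto simp: cubie_list map_eq_conv[of _ _ "\<lambda>x. x", simplified]\<close>)
next
  have "{(-3,-1,-3), (-3,3,-1), (1,-3,3)} \<subseteq> edge_cubies" by code_simp
  then show "(-3,-1,-3) \<in> edge_cubies" "(-3,3,-1) \<in> edge_cubies" "(1,-3,3) \<in> edge_cubies"
    by simp_all
qed (use assms edge_setups in auto)

lemma centre_cycles_realized:
  assumes "y \<in> CentGeom" "y \<noteq> (-1,-1,3)" "y \<noteq> (-1,1,3)"
  shows "swap (-1,-1,3) (-1,1,3) \<circ> swap (-1,-1,3) y \<in> realized edge_cubies corner_facets CentGeom"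
proof (rule realized_three_cycles[where x = "(1,3,1)"])
  show "swap (-1,-1,3) (-1,1,3) \<circ> swap (-1,-1,3) (1,3,1)
    \<in> realized edge_cubies corner_facets CentGeom"
    unfolding realized_def mem_Collect_eq
    by (rule exI[of _ centre_cycle])
      (use centre_cycle_effect run_corner_facets_fixed[of centre_cycle] in
        \<open>auto simp: cubie_list map_eq_conv[of _ _ "\<lambda>x. x", simplified]\<close>)
next
  have "{(-1,-1,3), (-1,1,3), (1,3,1)} \<subseteq> CentGeom" by code_simp
  then show "(-1,-1,3) \<in> CentGeom" "(-1,1,3) \<in> CentGeom" "(1,3,1) \<in> CentGeom"
    by simp_all
qed (use assms centre_setups in auto)

lemma centre_permutations:
  assumes "p permutes CentGeom"
  shows "p \<in> realized edge_cubies corner_facets CentGeom \<or>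
    swap (-1,-1,3) (-1,1,3) \<circ> p \<in> realized edge_cubies corner_facets CentGeom"
  by (rule permutes_up_to_swap[OF _ realized_id _ _ _ assms])
    (auto intro: realized_comp centre_cycles_realized)

lemma realized_cong:
  assumes "p \<in> realized M N S" "\<And>c. c \<in> S \<Longrightarrow> p c = q c"
  shows "q \<in> realized M N S"
  using assms by (auto simp: realized_def)

lemma realized_mono:
  assumes "p \<in> realized M N S" "M' \<subseteq> M" "N' \<subseteq> N"
  shows "p \<in> realized M' N' S"
  using assms by (fastforce simp: realized_def)

lemma inner_slice_effect:
  "map (run_piece (X 1 1)) (cubie_list 2)
    = map (swap (1,3,3) (1,-3,3) \<circ> (swap (1,-3,3) (1,-3,-3) \<circ> swap (1,-3,-3) (1,3,-3))) (cubie_list 2)"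
  "map (run_piece (X 1 4)) (cubie_list 2) = map id (cubie_list 2)"
  "map (run_facet (X 1 1)) (map base_facet (cubie_list 3)) = map base_facet (cubie_list 3)"
  "valid (X 1 1)" "{(1,3,3), (1,-3,3), (1,-3,-3), (1,3,-3)} \<subseteq> edge_cubies"
  by code_simp+

text \<open>
  A quarter turn of an inner slice moves no corner and permutes the edges by a single four-cycle, an
  odd permutation. This removes the parity condition on the edges, at the price of moving centres.
\<close>

lemma edge_permutations:
  assumes "p permutes edge_cubies"
  shows "p \<in> realized {} corner_facets edge_cubies"
proof -
  define K where "K = realized {} corner_facets edge_cubies"
  define a b :: vec where "a = (-3,-1,-3)" and "b = (-3,3,-1)"
  have comp: "p \<circ> q \<in> K" if "p \<in> K" "q \<in> K" for p q
    using that realized_comp by (simp add: K_def)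
  have id: "id \<in> K" by (simp add: K_def realized_id)
  have ab: "a \<noteq> b" by (simp add: a_def b_def)
  have cycle: "swap a b \<circ> swap a x \<in> K" if "x \<in> edge_cubies" "x \<noteq> a" "x \<noteq> b" for x
    using realized_mono[OF edge_cycles_realized[of x]] that by (simp add: K_def a_def b_def)
  define r where "r = run_piece (X 1 1)"
  have r: "r \<in> K"
    unfolding K_def realized_def r_def
    using inner_slice_effect run_corner_facets_fixed[of "X 1 1"] by auto
  have r_swaps: "r c = (swap (1,3,3) (1,-3,3) \<circ> (swap (1,-3,3) (1,-3,-3) \<circ> swap (1,-3,-3) (1,3,-3))) c"
    if "c \<in> edge_cubies" for c
    using inner_slice_effect(1) that unfolding r_def cubie_list map_eq_conv by blast
  have "swap a b \<circ> swap (1,3,3) (1,-3,3) \<in> K"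
    by (rule double_swaps(1)[of K a b edge_cubies, OF comp id ab cycle])
      (use inner_slice_effect(5) in auto)
  moreover have "swap a b \<circ> swap (1,-3,3) (1,-3,-3) \<in> K"
    by (rule double_swaps(1)[of K a b edge_cubies, OF comp id ab cycle])
      (use inner_slice_effect(5) in auto)
  moreover have "swap (1,-3,3) (1,-3,-3) \<circ> swap a b \<in> K"
    by (rule double_swaps(2)[of K a b edge_cubies, OF comp id ab cycle])
      (use inner_slice_effect(5) in auto)
  moreover have "swap a b \<circ> swap (1,-3,-3) (1,3,-3) \<in> K"
    by (rule double_swaps(1)[of K a b edge_cubies, OF comp id ab cycle])
      (use inner_slice_effect(5) in auto)
  ultimately have "(swap a b \<circ> swap (1,3,3) (1,-3,3)) \<circ> ((swap (1,-3,3) (1,-3,-3) \<circ> swap a b)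
      \<circ> (swap a b \<circ> swap (1,-3,-3) (1,3,-3))) \<in> K"
    using comp by blast
  then have "swap a b \<circ> r \<in> K"
    unfolding K_def by (rule realized_cong) (simp add: r_swaps)
  \<comment> \<open>\<open>r\<close> has order 4 on the edges, so this cancels \<open>r\<close>.\<close>
  then have "swap a b \<circ> r \<circ> (r \<circ> r \<circ> r) \<in> K" using r comp by blast
  then have swap: "swap a b \<in> K"
    unfolding K_def
  proof (rule realized_cong)
    fix c assume "c \<in> edge_cubies"
    then have "run_piece (X 1 4) c = id c"
      using inner_slice_effect(2) unfolding cubie_list map_eq_conv by blast
    then show "(swap a b \<circ> r \<circ> (r \<circ> r \<circ> r)) c = swap a b c"
      by (simp add: r_def X_def eval_nat_numeral)
  qed
  have "p \<in> K \<or> swap a b \<circ> p \<in> K"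
    by (rule permutes_up_to_swap[OF comp id ab cycle _ assms]) auto
  then show ?thesis
  proof
    assume "swap a b \<circ> p \<in> K"
    then have "swap a b \<circ> (swap a b \<circ> p) \<in> K" using comp swap by blast
    moreover have "swap a b \<circ> (swap a b \<circ> p) = p" by (auto simp: fun_eq_iff)
    ultimately show ?thesis by (simp add: K_def)
  qed (simp add: K_def)
qed

text \<open>
  Twists are left uncontrolled here; they are corrected afterwards.
\<close>

lemma corner_permutations:
  assumes "p permutes corner_cubies"
  shows "p \<in> realized {} {} corner_cubies"
proof -
  define K where "K = realized {} {} corner_cubies"
  define a b :: vec where "a = (3,-3,-3)" and "b = (3,3,3)"
  have comp: "p \<circ> q \<in> K" if "p \<in> K" "q \<in> K" for p q
    using that realized_comp by (simp add: K_def)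
  have id: "id \<in> K" by (simp add: K_def realized_id)
  have ab: "a \<noteq> b" by (simp add: a_def b_def)
  have ab': "swap a b \<in> K"
    unfolding K_def realized_def using corner_swap_effect
    by (auto simp: cubie_list a_def b_def intro!: exI[of _ corner_swap])
  have cycle: "swap a x \<in> K" if "x \<in> corner_cubies" "x \<noteq> a" for x
  proof -
    obtain g where g: "valid g" "run_piece g a = a" "run_piece g b = x"
      using corner_setups \<open>x \<in> corner_cubies\<close> \<open>x \<noteq> a\<close> by (auto simp: a_def b_def)
    show ?thesis
      unfolding K_def
      by (rule realized_conj[OF _ _ _ g(1) ab'[unfolded K_def]])
       (use run_piece_swap[OF g(1)] g in \<open>auto, metis\<close>)
  qed
  have "p \<in> K \<or> swap a b \<circ> p \<in> K"
    by (rule permutes_up_to_swap[OF comp id ab _ _ assms]) (use cycle ab' comp in auto)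
  then show ?thesis
  proof
    assume "swap a b \<circ> p \<in> K"
    then have "swap a b \<circ> (swap a b \<circ> p) \<in> K" using comp ab' by blast
    moreover have "swap a b \<circ> (swap a b \<circ> p) = p" by (auto simp: fun_eq_iff)
    ultimately show ?thesis by (simp add: K_def)
  qed (simp add: K_def)
qed


section \<open>Words that twist the corners\<close>

text \<open>
  The word may move edges and centres; these are put back separately.
\<close>

definition twisted :: "(vec \<Rightarrow> nat) \<Rightarrow> bool" where
  "twisted k \<longleftrightarrow> (\<exists>w. valid w \<and> (\<forall>x\<in>corner_facets. run_facet w x = (spin ^^ k (fst x)) x))"

lemma twisted_add:
  assumes "twisted k" "twisted l"
  shows "twisted (\<lambda>c. k c + l c)"
proof -
  obtain u w where "valid u" "valid w" "\<forall>x\<in>corner_facets. run_facet u x = (spin ^^ k (fst x)) x"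
    "\<forall>x\<in>corner_facets. run_facet w x = (spin ^^ l (fst x)) x"
    using assms by (auto simp: twisted_def)
  then show ?thesis
    unfolding twisted_def
    by (intro exI[of _ "u @ w"]) (auto simp: funpow_add spin_power_corner)
qed

lemma twisted_0: "twisted (\<lambda>c. 0)"
  unfolding twisted_def by (intro exI[of _ "[]"]) auto

lemma twisted_mult: "twisted k \<Longrightarrow> twisted (\<lambda>c. m * k c)"
  by (induction m) (auto simp: twisted_0 intro: twisted_add)

lemma spin_power_fixes: "x \<in> corner_facets \<Longrightarrow> (spin ^^ (3 * k)) x = x"
  by (induction k) (auto simp: eval_nat_numeral spin_corner)

lemma twisted_pair:
  assumes "c \<in> corner_cubies" "c \<noteq> (3,-3,-3)"
  shows "twisted (\<lambda>d. if d = c then 1 else if d = (3,-3,-3) then 2 else 0)"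
proof -
  obtain g where g: "valid g" "run_piece g (3,-3,-3) = (3,-3,-3)" "run_piece g (3,3,3) = c"
    using corner_setups assms by auto
  obtain u where u: "valid u" "\<And>x. run_facet u (run_facet g x) = x"
    "\<And>x. run_facet g (run_facet u x) = x"
    using inverse_word[OF g(1)] by metis
  have gu: "run_piece g (run_piece u c) = c" for c
    by (rule inverse_word_piece) (rule u(3))
  define k :: "vec \<Rightarrow> nat" where "k d = (if d = (3,3,3) then 1 else if d = (3,-3,-3) then 2 else 0)" for d
  have base: "run_facet corner_twist (base_facet d) = (spin ^^ k d) (base_facet d)"
    if "d \<in> corner_cubies" for d
  proof -
    have "run_facet corner_twist (base_facet d) = (\<lambda>x. if fst x = (3,3,3) then spin x else if fst x = (3,-3,-3) then spin (spin x) else x) (base_facet d)"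
      using corner_twist_effect(1) that unfolding cubie_list map_map comp_def map_eq_conv by blast
    then show ?thesis by (simp add: k_def eval_nat_numeral)
  qed
  have "bij_betw id corner_cubies corner_cubies" by simp
  then have "corner_map (\<lambda>x. (spin ^^ k (fst x)) x)"
    by (auto simp: corner_map_def spin_power_corner funpow_swap1 id_def intro!: exI[of _ id])
  from corner_map_eqI[OF corner_map_run(1)[OF corner_twist_effect(2)] this]
  have tw: "run_facet corner_twist x = (spin ^^ k (fst x)) x" if "x \<in> corner_facets" for x
    using base that by simp
  have k: "k (run_piece u d) = (if d = c then 1 else if d = (3,-3,-3) then 2 else 0)" for d
    using gu g run_piece_inj[OF g(1)] unfolding k_def by (smt (verit, best))
  show ?thesis
    unfolding twisted_def
  proof (intro exI conjI ballI)
    show "valid (g @ corner_twist @ u)" using g u corner_twist_effect by simp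
    fix x assume x: "x \<in> corner_facets"
    then have ux: "run_facet u x \<in> corner_facets" using run_facet_kind u(1) by blast
    have "run_facet (g @ corner_twist @ u) x = run_facet g ((spin ^^ k (run_piece u (fst x))) (run_facet u x))"
      using tw[OF ux] by simp
    also have "\<dots> = (spin ^^ k (run_piece u (fst x))) x"
      using corner_map_power[OF corner_map_run(1)[OF g(1)] ux] by (simp add: u)
    finally show "run_facet (g @ corner_twist @ u) x
      = (spin ^^ (if fst x = c then 1 else if fst x = (3,-3,-3) then 2 else 0)) x"
      by (simp only: k)
  qed
qed

text \<open>
  The corner \<open>(3, -3, -3)\<close> collects the compensating twists; two spins are the inverse of one.
\<close>

lemma twisted_sum:
  assumes "finite S" "S \<subseteq> corner_cubies - {(3,-3,-3)}"
  shows "twisted (\<lambda>d. if d \<in> S then m d else if d = (3,-3,-3) then 2 * sum m S else 0)"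
  using assms
proof (induction S)
  case empty
  then show ?case using twisted_0 by (simp cong: if_cong)
next
  case (insert c S)
  have "twisted (\<lambda>d. (if d \<in> S then m d else if d = (3,-3,-3) then 2 * sum m S else 0)
     + m c * (if d = c then 1 else if d = (3,-3,-3) then 2 else 0))"
    using insert by (intro twisted_add twisted_mult twisted_pair) auto
  also have "(\<lambda>d. (if d \<in> S then m d else if d = (3,-3,-3) then 2 * sum m S else 0)
     + m c * (if d = c then 1 else if d = (3,-3,-3) then 2 else 0))
    = (\<lambda>d. if d \<in> insert c S then m d else if d = (3,-3,-3) then 2 * sum m (insert c S) else 0)"
    using insert by (auto simp: fun_eq_iff)
  finally show ?case .
qed

lemma spin_power_cong:
  assumes "x \<in> corner_facets" "k mod 3 = l mod 3"
  shows "(spin ^^ k) x = (spin ^^ l) x"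
proof -
  have "(spin ^^ k) x = (spin ^^ (k mod 3)) x" for k
  proof -
    have "(spin ^^ k) x = (spin ^^ (k mod 3 + 3 * (k div 3))) x" by simp
    also have "\<dots> = (spin ^^ (k mod 3)) x"
      unfolding funpow_add comp_apply using spin_power_fixes[OF assms(1)] by simp
    finally show ?thesis .
  qed
  then show ?thesis using assms(2) by metis
qed

lemma corner_map_permutes:
  assumes "corner_map b"
  obtains p where "p permutes corner_cubies" "\<And>x. x \<in> corner_facets \<Longrightarrow> fst (b x) = p (fst x)"
proof -
  obtain p where p: "bij_betw p corner_cubies corner_cubies" "\<forall>x\<in>corner_facets. fst (b x) = p (fst x)"
    using assms by (auto simp: corner_map_def)
  have "(\<lambda>c. if c \<in> corner_cubies then p c else c) permutes corner_cubies"
    by (rule bij_imp_permutes) (use p(1) in \<open>auto cong: bij_betw_cong\<close>)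
  with that p(2) corner_facets_fst show thesis by simp
qed

text \<open>
  After the permutation of the corners has been undone, twists of seven corners can be chosen freely,
  and the vanishing total twist forces the twist of the last one.
\<close>

lemma untwisted_corner_map_realized:
  assumes b: "corner_map b" "twist b mod 3 = 0"
  obtains w where "valid w" "\<And>x. x \<in> corner_facets \<Longrightarrow> run_facet w x = b x"
proof -
  obtain p where p: "p permutes corner_cubies" "\<And>x. x \<in> corner_facets \<Longrightarrow> fst (b x) = p (fst x)"
    using corner_map_permutes[OF b(1)] by blast
  obtain w where w: "valid w" "\<And>c. c \<in> corner_cubies \<Longrightarrow> run_piece w c = p c"
    using corner_permutations[OF p(1)] by (auto simp: realized_def)
  obtain u where u: "valid u" "\<And>x. run_facet u (run_facet w x) = x"
    "\<And>x. run_facet w (run_facet u x) = x"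
    using inverse_word[OF w(1)] by metis
  define b' where "b' = run_facet u \<circ> b"
  have b': "corner_map b'" "twist b' mod 3 = 0"
    using corner_map_comp[OF corner_map_run(1)[OF u(1)] b(1)] b(2) corner_map_run(2)[OF u(1)]
    by (simp_all add: b'_def mod_eq_0_iff_dvd)
  have b'_fst: "fst (b' x) = fst x" if "x \<in> corner_facets" for x
  proof -
    have "run_piece u (run_piece w (fst x)) = fst x"
      by (rule inverse_word_piece) (rule u(2))
    with that w(2) p(2) show ?thesis by (simp add: b'_def corner_facets_fst)
  qed
  have b'_in: "b' x \<in> corner_facets" if "x \<in> corner_facets" for x
    using that b'(1) by (auto simp: corner_map_def)
  define a :: vec where "a = (3,-3,-3)"
  have a: "a \<in> corner_cubies" unfolding a_def by code_simp
  define m where "m c = twist_index (b' (base_facet c))" for c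
  define S where "S = corner_cubies - {a}"
  define k where "k = (\<lambda>d. if d \<in> S then m d else if d = a then 2 * sum m S else 0)"
  \<comment> \<open>\<open>k\<close> agrees with \<open>m\<close> except at \<open>a\<close>, where the vanishing of the total gives agreement modulo 3.\<close>
  have "twisted k"
    unfolding k_def a_def by (rule twisted_sum) (auto simp: S_def a_def)
  then obtain t where t: "valid t" "\<And>x. x \<in> corner_facets \<Longrightarrow> run_facet t x = (spin ^^ k (fst x)) x"
    by (auto simp: twisted_def)
  have "sum m corner_cubies = m a + sum m S"
    unfolding S_def using a by (simp add: sum.remove)
  with b'(2) have "(m a + sum m S) mod 3 = 0"
    by (simp add: twist_def m_def)
  have mod_3: "2 * j mod 3 = i mod 3" if "(i + j) mod 3 = 0" for i j :: nat
    using that by presburger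
  have "2 * sum m S mod 3 = m a mod 3"
    by (rule mod_3) fact
  then have km: "k c mod 3 = m c mod 3" if "c \<in> corner_cubies" for c
    using that by (auto simp: k_def S_def)
  have "run_facet t (base_facet c) = b' (base_facet c)" if c: "c \<in> corner_cubies" for c
  proof -
    note bc = base_facet_corner(1)[OF c]
    have "b' (base_facet c) = (spin ^^ m c) (base_facet c)"
      using spin_corner(1)[OF b'_in[OF bc]] b'_fst[OF bc] by (simp add: m_def)
    also have "\<dots> = (spin ^^ k c) (base_facet c)"
      by (rule spin_power_cong[OF bc]) (rule km[OF c, symmetric])
    finally show ?thesis using t(2)[OF bc] by simp
  qed
  then have tb': "run_facet t x = b' x" if "x \<in> corner_facets" for x
    using corner_map_eqI[OF corner_map_run(1)[OF t(1)] b'(1) _ that] by blast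
  show thesis
  proof
    show "valid (w @ t)" using w t by simp
    show "run_facet (w @ t) x = b x" if "x \<in> corner_facets" for x
      using tb'[OF that] u(3) by (simp add: b'_def)
  qed
qed


section \<open>Words realizing a whole configuration\<close>

lemma permutation_after_word:
  assumes "valid w" "invariant S" "p permutes S"
  obtains q where "q permutes S" "\<And>c. c \<in> S \<Longrightarrow> q (run_piece w c) = p c"
proof -
  obtain u where u: "valid u" "\<And>x. run_facet u (run_facet w x) = x"
    using inverse_word[OF assms(1)] by metis
  have S: "run_piece w c \<in> S" "run_piece u c \<in> S" if "c \<in> S" for c
    using that assms(1,2) u(1) by (auto simp: invariant_def)
  let ?q = "\<lambda>c. if c \<in> S then p (run_piece u c) else c"
  have "bij_betw (p \<circ> run_piece u) S S"
    using run_piece_bij[OF u(1) assms(2)] permutes_imp_bij[OF assms(3)] by (rule bij_betw_trans)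
  then have "?q permutes S"
    by (intro bij_imp_permutes) (auto cong: bij_betw_cong)
  moreover have "?q (run_piece w c) = p c" if "c \<in> S" for c
    using S(1)[OF that] inverse_word_piece[OF u(2)] by simp
  ultimately show thesis using that by blast
qed

text \<open>
  The corners are treated first, then the edges by a word that fixes the corners, then the centres by
  a word that fixes both.
\<close>

lemma word_realizing_configuration:
  assumes b: "corner_map b" "twist b mod 3 = 0"
    and p: "p permutes edge_cubies" and s: "s permutes CentGeom"
  obtains w where "valid w" "\<And>x. x \<in> corner_facets \<Longrightarrow> run_facet w x = b x"
    "\<And>c. c \<in> edge_cubies \<Longrightarrow> run_piece w c = p c"
    "(\<forall>c\<in>CentGeom. run_piece w c = s c) \<or>
     (\<forall>c\<in>CentGeom. run_piece w c = swap (-1,-1,3) (-1,1,3) (s c))"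
proof -
  obtain w1 where w1: "valid w1" "\<And>x. x \<in> corner_facets \<Longrightarrow> run_facet w1 x = b x"
    using untwisted_corner_map_realized[OF b] by blast
  obtain p' where p': "p' permutes edge_cubies" "\<And>c. c \<in> edge_cubies \<Longrightarrow> p' (run_piece w1 c) = p c"
    using permutation_after_word[OF w1(1) _ p] by auto
  obtain w2 where w2: "valid w2" "\<And>x. x \<in> corner_facets \<Longrightarrow> run_facet w2 x = x"
    "\<And>c. c \<in> edge_cubies \<Longrightarrow> run_piece w2 c = p' c"
    using edge_permutations[OF p'(1)] by (auto simp: realized_def)
  have w21: "valid (w2 @ w1)" using w1 w2 by simp
  obtain s' where s': "s' permutes CentGeom" "\<And>c. c \<in> CentGeom \<Longrightarrow> s' (run_piece (w2 @ w1) c) = s c"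
    using permutation_after_word[OF w21 _ s] by (metis invariants(3))
  obtain w3 where w3: "valid w3" "\<And>x. x \<in> corner_facets \<Longrightarrow> run_facet w3 x = x"
    "\<And>c. c \<in> edge_cubies \<Longrightarrow> run_piece w3 c = c"
    "(\<forall>c\<in>CentGeom. run_piece w3 c = s' c) \<or>
     (\<forall>c\<in>CentGeom. run_piece w3 c = swap (-1,-1,3) (-1,1,3) (s' c))"
    using centre_permutations[OF s'(1)] by (auto simp: realized_def)
  show thesis
  proof
    show "valid (w3 @ w2 @ w1)" using w1 w2 w3 by simp
    show "run_facet (w3 @ w2 @ w1) x = b x" if "x \<in> corner_facets" for x
    proof -
      have "b x \<in> corner_facets" using that b(1) unfolding corner_map_def by blast
      with that w1(2) w2(2) w3(2) show ?thesis by simp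
    qed
    show "run_piece (w3 @ w2 @ w1) c = p c" if "c \<in> edge_cubies" for c
      using that run_piece_kind(1)[OF w1(1)] run_piece_kind(1)[OF w2(1)] w2(3) w3(3) p'(2)
      by (metis run_append(1))
    show "(\<forall>c\<in>CentGeom. run_piece (w3 @ w2 @ w1) c = s c) \<or>
     (\<forall>c\<in>CentGeom. run_piece (w3 @ w2 @ w1) c = swap (-1,-1,3) (-1,1,3) (s c))"
      using w3(4) run_piece_kind(3)[OF w21] s'(2) by auto
  qed
qed


section \<open>Isomorphisms of bundles\<close>

definition closed_bundle :: "('p, 'f) piece_bundle \<Rightarrow> bool" where
  "closed_bundle A \<longleftrightarrow> (\<forall>x\<in>Facets A. gen A x \<in> Facets A \<and> proj A x \<in> Pieces A)"

lemma closed_bundleD: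
  assumes "closed_bundle A" "x \<in> Facets A"
  shows "(gen A ^^ m) x \<in> Facets A" "proj A x \<in> Pieces A"
  using assms by (induction m) (auto simp: closed_bundle_def)

lemma bundle_isoD:
  assumes "(f, F) \<in> bundle_iso k A B"
  shows "f \<in> extensional (Pieces A)" "bij_betw f (Pieces A) (Pieces B)"
    "F \<in> extensional (Facets A)" "bij_betw F (Facets A) (Facets B)"
    "\<And>x. x \<in> Facets A \<Longrightarrow> proj B (F x) = f (proj A x)"
    "\<And>m x. m < k \<Longrightarrow> x \<in> Facets A \<Longrightarrow> F ((gen A ^^ m) x) = (gen B ^^ m) (F x)"
  using assms by (auto simp: bundle_iso_def ext_bij_def)

lemma bundle_iso_mem:
  assumes "(f, F) \<in> bundle_iso k A B"
  shows "c \<in> Pieces A \<Longrightarrow> f c \<in> Pieces B" "x \<in> Facets A \<Longrightarrow> F x \<in> Facets B"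
  using bundle_isoD(2,4)[OF assms] by (auto simp: bij_betw_def)

lemma bundle_iso_comp:
  assumes A: "closed_bundle A" and f: "f \<in> bundle_iso k A B" and g: "g \<in> bundle_iso k B C"
  shows "bundle_comp A g f \<in> bundle_iso k A C"
proof -
  obtain fp fF gp gF where [simp]: "f = (fp, fF)" "g = (gp, gF)" by (cases f; cases g)
  note f' = bundle_isoD[OF f[simplified]] bundle_iso_mem[OF f[simplified]]
  note g' = bundle_isoD[OF g[simplified]] bundle_iso_mem[OF g[simplified]]
  have "bij_betw (compose (Pieces A) gp fp) (Pieces A) (Pieces C)"
    "bij_betw (compose (Facets A) gF fF) (Facets A) (Facets C)"
    using f' g' by (blast intro: bij_betw_compose)+
  then show ?thesis
    using f' g' closed_bundleD[OF A]
    by (simp add: bundle_iso_def bundle_comp_def ext_bij_def compose_eq)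
qed

lemma bundle_iso_id:
  "closed_bundle A \<Longrightarrow> (\<lambda>c\<in>Pieces A. c, \<lambda>x\<in>Facets A. x) \<in> bundle_iso k A A"
  by (auto simp: bundle_iso_def ext_bij_def closed_bundleD bij_betw_def inj_on_def)

definition bundle_inv ::
    "('p, 'f) piece_bundle \<Rightarrow> ('q, 'g) piece_bundle \<Rightarrow> ('p \<Rightarrow> 'q) \<times> ('f \<Rightarrow> 'g) \<Rightarrow> ('q \<Rightarrow> 'p) \<times> ('g \<Rightarrow> 'f)"
  where "bundle_inv A B f = (restrict (inv_into (Pieces A) (fst f)) (Pieces B),
     restrict (inv_into (Facets A) (snd f)) (Facets B))"

lemma bundle_iso_inv:
  assumes A: "closed_bundle A" and f: "f \<in> bundle_iso k A B"
  shows "bundle_inv A B f \<in> bundle_iso k B A"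
proof -
  obtain fp F where [simp]: "f = (fp, F)" by (cases f)
  note f' = bundle_isoD[OF f[simplified]]
  let ?h = "inv_into (Facets A) F"
  have h: "?h (F x) = x" if "x \<in> Facets A" for x
    using f'(4) that by (simp add: bij_betw_def)
  have hp: "inv_into (Pieces A) fp (fp c) = c" if "c \<in> Pieces A" for c
    using f'(2) that by (simp add: bij_betw_def)
  have onto: "\<exists>x\<in>Facets A. y = F x" if "y \<in> Facets B" for y
    using f'(4) that by (auto simp: bij_betw_def)
  have 1: "proj A (?h y) = inv_into (Pieces A) fp (proj B y) \<and> proj B y \<in> Pieces B" if "y \<in> Facets B" for y
    using onto[OF that] h hp f'(5) bundle_iso_mem[OF f[simplified]] closed_bundleD(2)[OF A] by auto
  have 2: "?h ((gen B ^^ m) y) = (gen A ^^ m) (?h y) \<and> (gen B ^^ m) y \<in> Facets B"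
    if y: "y \<in> Facets B" "m < k" for m y
  proof -
    obtain x where x: "x \<in> Facets A" "y = F x" using onto[OF y(1)] by blast
    have "(gen B ^^ m) y = F ((gen A ^^ m) x)" using f'(6)[OF y(2) x(1)] x by simp
    with x h closed_bundleD(1)[OF A x(1)] bundle_iso_mem(2)[OF f[simplified]] show ?thesis by simp
  qed
  show ?thesis
    unfolding bundle_inv_def bundle_iso_def ext_bij_def
    using bij_betw_inv_into[OF f'(2)] bij_betw_inv_into[OF f'(4)] 1 2 by simp
qed

lemma bundle_iso_right_quotient:
  assumes A: "closed_bundle A" "closed_bundle B"
    and f: "f \<in> bundle_iso k A B" and f': "f' \<in> bundle_iso k A B"
  obtains h where "h \<in> bundle_iso k B B" "bundle_comp A h f' = f"
proof
  let ?h = "bundle_comp B f (bundle_inv A B f')"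
  show "?h \<in> bundle_iso k B B"
    by (rule bundle_iso_comp[OF A(2) bundle_iso_inv[OF A(1) f'] f])
  obtain fp F fp' F' where [simp]: "f = (fp, F)" "f' = (fp', F')" by (cases f; cases f')
  note 1 = bundle_isoD[OF f[simplified]] bundle_iso_mem[OF f[simplified]]
  note 2 = bundle_isoD[OF f'[simplified]] bundle_iso_mem[OF f'[simplified]]
  have "compose (Pieces A) (compose (Pieces B) fp (restrict (inv_into (Pieces A) fp') (Pieces B))) fp' = fp"
    using 1(1) 2(2,7) by (auto simp: compose_def bij_betw_def extensional_def fun_eq_iff)
  moreover have "compose (Facets A) (compose (Facets B) F (restrict (inv_into (Facets A) F') (Facets B))) F' = F"
    using 1(3) 2(4,8) by (auto simp: compose_def bij_betw_def extensional_def fun_eq_iff)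
  ultimately show "bundle_comp A ?h f' = f"
    by (simp add: bundle_comp_def bundle_inv_def)
qed

lemma carrier_bundle_Aut [simp]: "carrier (bundle_Aut k A) = bundle_iso k A A"
  by (simp add: bundle_Aut_def)

lemma one_bundle_Aut [simp]: "\<one>\<^bsub>bundle_Aut k A\<^esub> = (\<lambda>c\<in>Pieces A. c, \<lambda>x\<in>Facets A. x)"
  by (simp add: bundle_Aut_def BijGroup_def DirProd_def)

lemma mult_bundle_Aut:
  assumes "g \<in> bundle_iso k A A" "f \<in> bundle_iso k A A"
  shows "g \<otimes>\<^bsub>bundle_Aut k A\<^esub> f = bundle_comp A g f"
  using assms
  by (auto simp: bundle_Aut_def BijGroup_def DirProd_def bundle_comp_def bundle_iso_def ext_bij_def Bij_def)

lemma monoid_bundle_Aut: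
  assumes "closed_bundle A"
  shows "monoid (bundle_Aut k A)"
proof (rule monoidI)
  let ?G = "BijGroup (Pieces A) \<times>\<times> BijGroup (Facets A)"
  interpret G: group ?G
    by (rule DirProd_group[OF group_BijGroup group_BijGroup])
  have mult: "x \<otimes>\<^bsub>bundle_Aut k A\<^esub> y = x \<otimes>\<^bsub>?G\<^esub> y" "\<one>\<^bsub>bundle_Aut k A\<^esub> = \<one>\<^bsub>?G\<^esub>" for x y
    by (simp_all add: bundle_Aut_def DirProd_def)
  have sub: "x \<in> carrier ?G" if "x \<in> carrier (bundle_Aut k A)" for x
    using that by (auto simp: bundle_iso_def ext_bij_def BijGroup_def Bij_def)
  show "x \<otimes>\<^bsub>bundle_Aut k A\<^esub> y \<in> carrier (bundle_Aut k A)"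
    if "x \<in> carrier (bundle_Aut k A)" "y \<in> carrier (bundle_Aut k A)" for x y
    using that bundle_iso_comp[OF assms] by (simp add: mult_bundle_Aut)
  show "\<one>\<^bsub>bundle_Aut k A\<^esub> \<in> carrier (bundle_Aut k A)"
    using bundle_iso_id[OF assms] by simp
  show "x \<otimes>\<^bsub>bundle_Aut k A\<^esub> y \<otimes>\<^bsub>bundle_Aut k A\<^esub> z = x \<otimes>\<^bsub>bundle_Aut k A\<^esub> (y \<otimes>\<^bsub>bundle_Aut k A\<^esub> z)"
    if "x \<in> carrier (bundle_Aut k A)" "y \<in> carrier (bundle_Aut k A)" "z \<in> carrier (bundle_Aut k A)" for x y z
    unfolding mult using that sub G.m_assoc by blast
  show "\<one>\<^bsub>bundle_Aut k A\<^esub> \<otimes>\<^bsub>bundle_Aut k A\<^esub> x = x" "x \<otimes>\<^bsub>bundle_Aut k A\<^esub> \<one>\<^bsub>bundle_Aut k A\<^esub> = x"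
    if "x \<in> carrier (bundle_Aut k A)" for x
    unfolding mult using that sub G.l_one G.r_one by blast+
qed

text \<open>
  Every piece that has facets has exactly two of them, exchanged by the generator. For such bundles
  equivariance is automatic (\<open>twofold_iso\<close>).
\<close>

definition twofold :: "('p, 'f) piece_bundle \<Rightarrow> bool" where
  "twofold A \<longleftrightarrow> (\<forall>x\<in>Facets A. proj A x \<in> Pieces A \<and> gen A x \<in> Facets A \<and> proj A (gen A x) = proj A x \<and> gen A x \<noteq> x \<and>
     (\<forall>y\<in>Facets A. proj A y = proj A x \<longrightarrow> y = x \<or> y = gen A x))"

lemma twofold_closed: "twofold A \<Longrightarrow> closed_bundle A"
  unfolding twofold_def closed_bundle_def by simp

lemma twofoldD:
  assumes "twofold A" "x \<in> Facets A"
  shows "gen A x \<in> Facets A" "proj A (gen A x) = proj A x" "gen A x \<noteq> x"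
    "\<And>y. y \<in> Facets A \<Longrightarrow> proj A y = proj A x \<Longrightarrow> y \<noteq> x \<Longrightarrow> y = gen A x"
proof -
  have *: "proj A x \<in> Pieces A \<and> gen A x \<in> Facets A \<and> proj A (gen A x) = proj A x \<and> gen A x \<noteq> x \<and>
     (\<forall>y\<in>Facets A. proj A y = proj A x \<longrightarrow> y = x \<or> y = gen A x)"
    using assms(1) unfolding twofold_def by (rule bspec) (rule assms(2))
  then show "gen A x \<in> Facets A" "proj A (gen A x) = proj A x" "gen A x \<noteq> x" by simp_all
  fix y assume "y \<in> Facets A" "proj A y = proj A x" "y \<noteq> x"
  with * show "y = gen A x" by metis
qed

lemma twofold_gen_gen:
  assumes "twofold A" "x \<in> Facets A"
  shows "gen A (gen A x) = x"
proof (rule sym, rule twofoldD(4)[OF assms(1)])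
  show "x \<noteq> gen A x" using twofoldD(3)[OF assms] by (rule not_sym)
  show "gen A x \<in> Facets A" "proj A x = proj A (gen A x)" "x \<in> Facets A"
    using twofoldD(1,2)[OF assms] assms(2) by simp_all
qed

lemma twofold_iso:
  assumes A: "twofold A" and B: "twofold B"
    and f: "f \<in> ext_bij (Pieces A) (Pieces B)" "F \<in> ext_bij (Facets A) (Facets B)"
    and over: "\<And>x. x \<in> Facets A \<Longrightarrow> proj B (F x) = f (proj A x)"
  shows "(f, F) \<in> bundle_iso 2 A B"
proof -
  have "F (gen A x) = gen B (F x)" if x: "x \<in> Facets A" for x
  proof -
    have g: "gen A x \<in> Facets A" "proj A (gen A x) = proj A x" "gen A x \<noteq> x"
      using twofoldD[OF A x] by blast+
    have "F x \<in> Facets B" "F (gen A x) \<in> Facets B" "F (gen A x) \<noteq> F x"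
      using f(2) x g by (auto simp: ext_bij_def bij_betw_def inj_on_def)
    moreover have "proj B (F (gen A x)) = proj B (F x)"
      using over x g by simp
    ultimately show ?thesis using twofoldD(4)[OF B] by blast
  qed
  with f over show ?thesis
    by (auto simp: bundle_iso_def less_2_cases_iff)
qed

lemma other_facet_eq:
  assumes "y \<in> S" "pr y = pr x" "y \<noteq> x" "\<And>z. z \<in> S \<Longrightarrow> pr z = pr x \<Longrightarrow> z \<noteq> x \<Longrightarrow> z = y"
  shows "other_facet S pr x = y"
  unfolding other_facet_def
proof (rule the_equality)
  show "y \<in> S \<and> pr y = pr x \<and> y \<noteq> x" using assms(1-3) by simp
  fix z assume "z \<in> S \<and> pr z = pr x \<and> z \<noteq> x"
  then show "z = y" using assms(4) by blast
qed


section \<open>The geometric bundles and the legal moves\<close>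

lemma ArGeom_simps [simp]: "Pieces ArGeom = edge_cubies" "Facets ArGeom = edge_facets" "proj ArGeom = fst"
  by (simp_all add: ArGeom_def edge_facets_def)

lemma SomGeom_simps [simp]: "Pieces SomGeom = corner_cubies" "Facets SomGeom = corner_facets" "proj SomGeom = fst"
    "gen SomGeom = spin"
  by (simp_all add: SomGeom_def corner_facets_def spin_def)

lemma edge_facet_pair:
  assumes "x \<in> edge_facets"
  obtains y where "y \<in> edge_facets" "fst y = fst x" "y \<noteq> x" "chirality y = - chirality x"
    "chirality x \<in> {24, -24}" "\<And>z. z \<in> edge_facets \<Longrightarrow> fst z = fst x \<Longrightarrow> z = x \<or> z = y"
proof -
  obtain c n where x: "x = (c, n)" by (cases x)
  then have c: "c \<in> edge_cubies" "c \<in> cubies" "n \<in> normals" "dot c n = 3"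
    using assms by (auto simp: edge_facets_def geom_facets_def)
  from bspec[OF edge_has_opposite_chiralities c(1)]
  obtain n1 n2 where n: "n1 \<noteq> n2" "{a\<in>normals. dot c a = 3} = {n1, n2}"
    "chirality (c, n1) = 24" "chirality (c, n2) = -24"
    by (elim bexE conjE) rule
  have F: "(c, m) \<in> edge_facets \<longleftrightarrow> m \<in> {n1, n2}" for m
    using c unfolding n(2)[symmetric] by (auto simp: edge_facets_def geom_facets_def)
  have "n \<in> {n1, n2}" using F assms by (simp add: x)
  then consider "n = n1" | "n = n2" by blast
  then show thesis
  proof cases
    case 1
    show thesis
      by (rule that[of "(c, n2)"]) (use n F 1 in \<open>auto simp: x\<close>)
  next
    case 2
    show thesis
      by (rule that[of "(c, n1)"]) (use n F 2 in \<open>auto simp: x\<close>)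
  qed
qed

lemma ArGeom_gen:
  assumes "x \<in> edge_facets"
  shows "gen ArGeom x \<in> edge_facets" "fst (gen ArGeom x) = fst x" "gen ArGeom x \<noteq> x"
    "chirality (gen ArGeom x) = - chirality x" "chirality x \<in> {24, -24}"
    "\<And>z. z \<in> edge_facets \<Longrightarrow> fst z = fst x \<Longrightarrow> z = x \<or> z = gen ArGeom x"
proof -
  obtain y where y: "y \<in> edge_facets" "fst y = fst x" "y \<noteq> x" "chirality y = - chirality x"
    "chirality x \<in> {24, -24}" "\<And>z. z \<in> edge_facets \<Longrightarrow> fst z = fst x \<Longrightarrow> z = x \<or> z = y"
    using edge_facet_pair[OF assms] by blast
  have "gen ArGeom x = y"
    unfolding ArGeom_def edge_facets_def[symmetric] piece_bundle.simps
    using y by (intro other_facet_eq) blast+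
  with y show "gen ArGeom x \<in> edge_facets" "fst (gen ArGeom x) = fst x" "gen ArGeom x \<noteq> x"
    "chirality (gen ArGeom x) = - chirality x" "chirality x \<in> {24, -24}"
    "\<And>z. z \<in> edge_facets \<Longrightarrow> fst z = fst x \<Longrightarrow> z = x \<or> z = gen ArGeom x"
    by blast+
qed

lemma twofold_ArGeom: "twofold ArGeom"
  using ArGeom_gen by (auto simp: twofold_def edge_facets_def)

lemmas closed_ArGeom = twofold_closed[OF twofold_ArGeom]

lemma closed_SomGeom: "closed_bundle SomGeom"
  using spin_corner(3) by (auto simp: closed_bundle_def corner_facets_def)

definition transf :: "word \<Rightarrow> geom_transf" where
  "transf w =
    ((restrict (run_piece w) edge_cubies, restrict (run_facet w) edge_facets),
     (restrict (run_piece w) corner_cubies, restrict (run_facet w) corner_facets),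
     restrict (run_piece w) CentGeom)"

lemma run_facet_bij:
  assumes "valid w" "invariant_facets S"
  shows "bij_betw (run_facet w) S S"
proof -
  obtain u where u: "valid u" "\<And>x. run_facet u (run_facet w x) = x"
    "\<And>x. run_facet w (run_facet u x) = x"
    using inverse_word[OF assms(1)] by metis
  show ?thesis
  proof (rule bij_betwI[where g = "run_facet u"])
    show "run_facet w \<in> S \<rightarrow> S" "run_facet u \<in> S \<rightarrow> S"
      using assms u(1) unfolding invariant_facets_def by blast+
  qed (rule u)+
qed

lemma invariant_edge_facets [simp]: "invariant_facets edge_facets"
  by (auto simp: invariant_facets_def intro: run_facet_kind)

lemma transf_edges:
  assumes "valid w"
  shows "(restrict (run_piece w) edge_cubies, restrict (run_facet w) edge_facets)
    \<in> bundle_iso 2 ArGeom ArGeom"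
proof (rule twofold_iso[OF twofold_ArGeom twofold_ArGeom])
  show "proj ArGeom (restrict (run_facet w) edge_facets x) = restrict (run_piece w) edge_cubies (proj ArGeom x)"
    if "x \<in> Facets ArGeom" for x
    using that by (simp add: edge_facets_def)
qed (use run_piece_bij[OF assms] run_facet_bij[OF assms] in
      \<open>auto simp: ext_bij_def cong: bij_betw_cong\<close>)

lemma transf_corners:
  assumes "valid w"
  shows "(restrict (run_piece w) corner_cubies, restrict (run_facet w) corner_facets)
    \<in> bundle_iso 3 SomGeom SomGeom"
  using run_piece_bij[OF assms] run_facet_bij[OF assms] corner_map_power[OF corner_map_run(1)[OF assms]]
  by (auto simp: bundle_iso_def ext_bij_def spin_power_corner corner_facets_fst cong: bij_betw_cong)

lemma transf_centres:
  assumes "valid w"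
  shows "restrict (run_piece w) CentGeom \<in> ext_bij CentGeom CentGeom"
  using run_piece_bij[OF assms] by (auto simp: ext_bij_def cong: bij_betw_cong)

lemma carrier_BijGroup [simp]: "carrier (BijGroup S) = ext_bij S S"
  by (auto simp: BijGroup_def Bij_def ext_bij_def)

lemma transf_carrier: "valid w \<Longrightarrow> transf w \<in> carrier T_geom"
  by (simp add: transf_def T_geom_def transf_edges transf_corners transf_centres)

lemma transf_mult:
  assumes "valid u" "valid w"
  shows "transf u \<otimes>\<^bsub>T_geom\<^esub> transf w = transf (u @ w)"
proof -
  have c: "restrict (run_piece u) CentGeom \<otimes>\<^bsub>BijGroup CentGeom\<^esub> restrict (run_piece w) CentGeom
    = compose CentGeom (restrict (run_piece u) CentGeom) (restrict (run_piece w) CentGeom)"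
    using transf_centres[OF assms(1)] transf_centres[OF assms(2)]
    by (simp add: BijGroup_def Bij_def ext_bij_def)
  have "compose S (restrict (run_piece u) S) (restrict (run_piece w) S) = restrict (run_piece (u @ w)) S"
    if "invariant S" for S
    using that assms(2) by (auto simp: invariant_def compose_def fun_eq_iff)
  moreover have "compose S (restrict (run_facet u) S) (restrict (run_facet w) S) = restrict (run_facet (u @ w)) S"
    if "invariant_facets S" for S
    using that assms(2) by (auto simp: invariant_facets_def compose_def fun_eq_iff)
  ultimately show ?thesis
    by (simp add: T_geom_def transf_def mult_bundle_Aut transf_edges transf_corners assms
        bundle_comp_def c)
qed

lemma monoid_T_geom: "monoid T_geom"
  unfolding T_geom_def
  by (intro DirProd_monoid monoid_bundle_Aut closed_ArGeom closed_SomGeom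
      group.is_monoid group_BijGroup)

lemma transf_one: "\<one>\<^bsub>T_geom\<^esub> = transf []"
  by (auto simp: T_geom_def transf_def BijGroup_def fun_eq_iff)

lemma slice_move_transf: "slice_move e v = transf [(e, v)]"
  by (auto simp: slice_move_def transf_def fun_eq_iff)

lemma transf_cong:
  assumes "\<And>x. run_facet u x = run_facet w x"
  shows "transf u = transf w"
proof -
  have "run_piece u c = run_piece w c" for c
    using arg_cong[OF assms[of "(c, 0)"], of fst] by simp
  with assms show ?thesis by (simp add: transf_def cong: restrict_cong)
qed

lemma inv_transf:
  assumes "valid w"
  obtains u where "valid u" "inv\<^bsub>T_geom\<^esub> (transf w) = transf u"
proof -
  obtain u where u: "valid u" "\<And>x. run_facet u (run_facet w x) = x"
    "\<And>x. run_facet w (run_facet u x) = x"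
    using inverse_word[OF assms] by metis
  have "transf u = inv\<^bsub>T_geom\<^esub> (transf w)"
  proof (rule monoid.inv_unique'[OF monoid_T_geom])
    show "transf w \<otimes>\<^bsub>T_geom\<^esub> transf u = \<one>\<^bsub>T_geom\<^esub>"
      unfolding transf_mult[OF assms u(1)] transf_one by (rule transf_cong) (simp add: u)
    show "transf u \<otimes>\<^bsub>T_geom\<^esub> transf w = \<one>\<^bsub>T_geom\<^esub>"
      unfolding transf_mult[OF u(1) assms] transf_one by (rule transf_cong) (simp add: u)
  qed (use assms u in \<open>simp_all add: transf_carrier\<close>)
  with u(1) that show thesis by metis
qed

text \<open>
  Inverses of words are words, so the generated subgroup consists of the transformations given by
  words alone.
\<close>

lemma legal_moves_eq: "legal_moves = transf ` {w. valid w}"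
proof
  let ?M = "{slice_move e v | e v. e \<in> axes \<and> v \<in> slices}"
  have M: "\<exists>w. valid w \<and> m = transf w" if m: "m \<in> ?M" for m
  proof -
    obtain e v where "e \<in> axes" "v \<in> slices" "m = slice_move e v" using m by blast
    then show ?thesis by (intro exI[of _ "[(e, v)]"]) (simp add: slice_move_transf)
  qed
  show "legal_moves \<subseteq> transf ` {w. valid w}"
  proof
    fix x assume "x \<in> legal_moves"
    then have "x \<in> generate T_geom ?M" by (simp only: legal_moves_def)
    then show "x \<in> transf ` {w. valid w}"
    proof (induction rule: generate.induct)
      case one
      then show ?case using transf_one by (auto intro!: image_eqI[of _ _ "[]"])
    next
      case (incl h)
      from M[OF incl] show ?case by auto
    next
      case (inv h)
      from M[OF inv] obtain w where "valid w" "h = transf w" by blast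
      moreover obtain u where "valid u" "inv\<^bsub>T_geom\<^esub> (transf w) = transf u"
        using inv_transf[OF \<open>valid w\<close>] by blast
      ultimately show ?case by auto
    next
      case (eng h1 h2)
      then obtain u w where "valid u" "valid w" "h1 = transf u" "h2 = transf w" by blast
      then show ?case by (auto simp: transf_mult intro!: image_eqI[of _ _ "u @ w"])
    qed
  qed
  show "transf ` {w. valid w} \<subseteq> legal_moves"
  proof (rule image_subsetI)
    fix w assume "w \<in> {w. valid w}"
    then have "valid w" by simp
    then show "transf w \<in> legal_moves"
    proof (induction w)
      case Nil
      show ?case unfolding legal_moves_def transf_one[symmetric] by (rule generate.one)
    next
      case (Cons m w)
      obtain e v where m: "m = (e, v)" by (cases m)
      have ev: "e \<in> axes" "v \<in> slices" "valid w" "valid [(e, v)]" using Cons.prems by (auto simp: m)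
      have "transf (m # w) = slice_move e v \<otimes>\<^bsub>T_geom\<^esub> transf w"
        using transf_mult[OF ev(4,3)] by (simp add: slice_move_transf m)
      also have "\<dots> \<in> generate T_geom ?M"
      proof (rule generate.eng)
        show "slice_move e v \<in> generate T_geom ?M"
          using ev(1,2) by (intro generate.incl) blast
        show "transf w \<in> generate T_geom ?M"
          using Cons.IH[OF ev(3)] by (simp only: legal_moves_def)
      qed
      finally show ?case by (simp only: legal_moves_def)
    qed
  qed
qed


section \<open>Counting edge isomorphisms\<close>

definition colour_pairs :: "colour set set" where
  "colour_pairs = {P. card P = 2 \<and> compatible P}"

lemma UNIV_colour: "(UNIV :: colour set) = {Blanc, Jaune, Bleu, Vert, Orange, Rouge}"
  using colour.exhaust by auto

lemma finite_colours [simp]: "finite (C :: colour set)"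
proof -
  have "finite (UNIV :: colour set)"
    by (simp only: UNIV_colour finite_insert finite.emptyI)
  then show ?thesis by (rule finite_subset[OF subset_UNIV])
qed

lemma finite_colour_sets [simp]: "finite (C :: colour set set)"
  by (rule finite_subset[of _ "Pow UNIV"]) (simp, simp del: Pow_UNIV)

lemma card_colour_pairs: "card colour_pairs = 12"
proof -
  have "colour_pairs = {P \<in> Pow {Blanc, Jaune, Bleu, Vert, Orange, Rouge}. card P = 2 \<and> compatible P}"
    unfolding UNIV_colour[symmetric] by (simp add: colour_pairs_def)
  also have "card \<dots> = 12" by code_simp
  finally show ?thesis .
qed

lemma ArMat_simps [simp]:
  "Pieces ArMat = colour_pairs \<times> {1, 2}"
  "Facets ArMat = {(P, j, a). P \<in> colour_pairs \<and> j \<in> {1, 2} \<and> a \<in> P}"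
  "proj ArMat (P, j, a) = (P, j)"
  by (auto simp: ArMat_def colour_pairs_def edge_facets_mat_def)

lemma ArMat_gen:
  assumes "P \<in> colour_pairs" "P = {a, b}" "j \<in> {1, 2}"
  shows "gen ArMat (P, j, a) = (P, j, b)" "a \<noteq> b"
proof -
  show ab: "a \<noteq> b" using assms by (auto simp: colour_pairs_def)
  have "other_facet edge_facets_mat (\<lambda>(P, j, a). (P, j)) (P, j, a) = (P, j, b)"
    by (rule other_facet_eq) (use assms ab in \<open>auto simp: colour_pairs_def edge_facets_mat_def\<close>)
  then show "gen ArMat (P, j, a) = (P, j, b)" by (simp add: ArMat_def)
qed

lemma colour_pair_cases:
  assumes "P \<in> colour_pairs" "a \<in> P"
  obtains b where "P = {a, b}"
  using assms by (auto simp: colour_pairs_def card_2_iff)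

lemma twofold_ArMat: "twofold ArMat"
  unfolding twofold_def
proof
  fix x assume "x \<in> Facets ArMat"
  then obtain P j a where x: "x = (P, j, a)" "P \<in> colour_pairs" "j \<in> {1, 2}" "a \<in> P" by auto
  obtain b where P: "P = {a, b}" using colour_pair_cases[OF x(2,4)] .
  note g = ArMat_gen[OF x(2) P x(3)]
  show "proj ArMat x \<in> Pieces ArMat \<and> gen ArMat x \<in> Facets ArMat \<and> proj ArMat (gen ArMat x) = proj ArMat x \<and>
    gen ArMat x \<noteq> x \<and> (\<forall>y\<in>Facets ArMat. proj ArMat y = proj ArMat x \<longrightarrow> y = x \<or> y = gen ArMat x)"
    unfolding x(1) g(1) using g(2) x P by (auto simp: doubleton_eq_iff)
qed

lemmas closed_ArMat = twofold_closed[OF twofold_ArMat]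

definition positive_facets :: "(vec \<times> vec) set" where
  "positive_facets = {x \<in> edge_facets. chirality x = 24}"

lemma positive_or_gen: "x \<in> edge_facets \<Longrightarrow> x \<in> positive_facets \<longleftrightarrow> gen ArGeom x \<notin> positive_facets"
  using ArGeom_gen(1,4,5)[of x] by (auto simp: positive_facets_def)

text \<open>
  The two facets of a material edge come from the two facets of one geometric edge, which have
  opposite chiralities.
\<close>

lemma positive_image:
  assumes f: "(f, F) \<in> bundle_iso 2 ArGeom ArMat" and y: "y \<in> Facets ArMat"
  shows "y \<in> F ` positive_facets \<longleftrightarrow> gen ArMat y \<notin> F ` positive_facets"
proof -
  note f' = bundle_isoD[OF f]
  have inj: "inj_on F edge_facets" using f'(4) by (simp add: bij_betw_def)
  have sub: "positive_facets \<subseteq> edge_facets" by (auto simp: positive_facets_def)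
  have "y \<in> F ` edge_facets" using f'(4) y by (simp add: bij_betw_def del: ArMat_simps(2))
  then obtain x where x: "x \<in> edge_facets" "y = F x" by blast
  have "gen ArMat y = F (gen ArGeom x)" using f'(6)[of 1 x] x by simp
  then show ?thesis
    using inj_on_image_mem_iff[OF inj _ sub] x ArGeom_gen(1)[OF x(1)] positive_or_gen[OF x(1)] by simp
qed

text \<open>
  The obstruction to solving the edges: in a solvable state, the two edges of a pair show the two
  different colours of the pair on the side of positive chirality.
\<close>

definition matched :: "(vec \<times> vec \<Rightarrow> colour set \<times> nat \<times> colour) \<Rightarrow> colour set set" where
  "matched F = {P \<in> colour_pairs. \<exists>a\<in>P. (P, 1, a) \<in> F ` positive_facets \<and> (P, 2, a) \<in> F ` positive_facets}"

definition flip :: "colour set set \<Rightarrow> colour set \<times> nat \<times> colour \<Rightarrow> colour set \<times> nat \<times> colour" where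
  "flip S y = (if fst y \<in> S \<and> fst (snd y) = 1 then gen ArMat y else y)"

definition flip_first where
  "flip_first S = (\<lambda>c\<in>Pieces ArMat. c, restrict (flip S) (Facets ArMat))"

lemma flip_facet:
  assumes "y \<in> Facets ArMat"
  shows "flip S y \<in> Facets ArMat" "proj ArMat (flip S y) = proj ArMat y" "flip S (flip S y) = y"
proof -
  have "proj ArMat z = (fst z, fst (snd z))" for z by (cases z) simp
  then show "flip S y \<in> Facets ArMat" "proj ArMat (flip S y) = proj ArMat y" "flip S (flip S y) = y"
    using twofoldD(1,2)[OF twofold_ArMat assms] twofold_gen_gen[OF twofold_ArMat assms] assms
    unfolding flip_def by (auto simp del: ArMat_simps)
qed

lemma flip_first_iso: "flip_first S \<in> bundle_iso 2 ArMat ArMat"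
  unfolding flip_first_def
proof (rule twofold_iso[OF twofold_ArMat twofold_ArMat])
  have "bij_betw (flip S) (Facets ArMat) (Facets ArMat)"
    by (rule bij_betwI[where g = "flip S"]) (use flip_facet in blast)+
  then show "restrict (flip S) (Facets ArMat) \<in> ext_bij (Facets ArMat) (Facets ArMat)"
    by (simp add: ext_bij_def del: ArMat_simps cong: bij_betw_cong)
  show "(\<lambda>c\<in>Pieces ArMat. c) \<in> ext_bij (Pieces ArMat) (Pieces ArMat)"
    by (simp add: ext_bij_def bij_betw_def inj_on_def del: ArMat_simps)
  show "proj ArMat (restrict (flip S) (Facets ArMat) x) = restrict (\<lambda>c. c) (Pieces ArMat) (proj ArMat x)"
    if "x \<in> Facets ArMat" for x
    using that flip_facet(2) closed_bundleD(2)[OF closed_ArMat that] by (simp del: ArMat_simps)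
qed

lemma flip_first_involution:
  assumes "f \<in> bundle_iso 2 ArGeom ArMat"
  shows "bundle_comp ArGeom (flip_first S) (bundle_comp ArGeom (flip_first S) f) = f"
proof -
  obtain fp F where f: "f = (fp, F)" by (cases f)
  note f' = bundle_isoD[OF assms[unfolded f]] bundle_iso_mem[OF assms[unfolded f]]
  show ?thesis
    using f' flip_facet
    by (auto simp: f bundle_comp_def flip_first_def compose_def extensional_def fun_eq_iff simp del: ArMat_simps)
qed

text \<open>
  Turning over the first edge of a pair, and not the second, exchanges the cases of equal and of
  different colours on the positive side.
\<close>

lemma matched_flip:
  assumes f: "f \<in> bundle_iso 2 ArGeom ArMat" and S: "S \<subseteq> colour_pairs"
  shows "matched (snd (bundle_comp ArGeom (flip_first S) f)) = (matched (snd f) - S) \<union> (S - matched (snd f))"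
proof -
  obtain fp F where f': "f = (fp, F)" by (cases f)
  let ?F = "snd (bundle_comp ArGeom (flip_first S) f)"
  define I where "I = F ` positive_facets"
  have sub: "positive_facets \<subseteq> edge_facets" by (auto simp: positive_facets_def)
  have I: "I \<subseteq> Facets ArMat"
    using bundle_iso_mem(2)[OF f[unfolded f']] sub by (auto simp: I_def simp del: ArMat_simps)
  have "?F x = flip S (F x)" if "x \<in> positive_facets" for x
    using that sub bundle_iso_mem(2)[OF f[unfolded f']]
    by (auto simp: bundle_comp_def f' flip_first_def compose_def simp del: ArMat_simps)
  then have img: "?F ` positive_facets = flip S ` I"
    by (force simp: I_def)
  have mem: "y \<in> flip S ` I \<longleftrightarrow> flip S y \<in> I" if "y \<in> Facets ArMat" for y
  proof
    assume "y \<in> flip S ` I"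
    then obtain z where "z \<in> I" "y = flip S z" by blast
    moreover have "z \<in> Facets ArMat" using I \<open>z \<in> I\<close> ..
    ultimately show "flip S y \<in> I" using flip_facet(3)[of z S] by simp
  next
    assume "flip S y \<in> I"
    then have "flip S (flip S y) \<in> flip S ` I" by (rule imageI)
    then show "y \<in> flip S ` I" using flip_facet(3)[OF that] by simp
  qed
  have one: "y \<in> I \<longleftrightarrow> gen ArMat y \<notin> I" if "y \<in> Facets ArMat" for y
    using positive_image[OF f[unfolded f'] that] by (simp add: I_def)
  have "P \<in> matched ?F \<longleftrightarrow> (P \<in> matched F \<longleftrightarrow> P \<notin> S)" if P: "P \<in> colour_pairs" for P
  proof -
    obtain a b where ab: "P = {a, b}" using P by (auto simp: colour_pairs_def card_2_iff)
    have fac: "(P, j, c) \<in> Facets ArMat" if "j \<in> {1, 2}" "c \<in> P" for j c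
      using that P by auto
    have g: "gen ArMat (P, j, a) = (P, j, b)" "gen ArMat (P, j, b) = (P, j, a)" if "j \<in> {1, 2}" for j
      using ArMat_gen(1)[OF P ab that] ArMat_gen(1)[OF P _ that, of b a] ab by (simp_all add: insert_commute)
    have u: "(P, j, b) \<in> I \<longleftrightarrow> (P, j, a) \<notin> I" if "j \<in> {1, 2}" for j
      using one[OF fac[OF that, of a]] g[OF that] ab by simp
    have fl: "flip S (P, 2, c) = (P, 2, c)"
      "flip S (P, 1, c) = (if P \<in> S then gen ArMat (P, 1, c) else (P, 1, c))" for c
      by (simp_all add: flip_def)
    have "P \<in> matched ?F \<longleftrightarrow> (\<exists>c\<in>P. flip S (P, 1, c) \<in> I \<and> flip S (P, 2, c) \<in> I)"
      using P mem fac unfolding matched_def img by (simp del: ArMat_simps)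
    moreover have "P \<in> matched F \<longleftrightarrow> (\<exists>c\<in>P. (P, 1, c) \<in> I \<and> (P, 2, c) \<in> I)"
      using P by (simp add: matched_def I_def)
    ultimately show ?thesis
      using u[of 1] u[of 2] g[of 1] unfolding fl by (auto simp: ab)
  qed
  moreover have "matched ?F \<subseteq> colour_pairs" "matched F \<subseteq> colour_pairs"
    by (auto simp: matched_def)
  ultimately show ?thesis using S unfolding f' by auto
qed

lemma card_equal_fibres:
  assumes "finite U" "finite T" "g ` U \<subseteq> T" "\<And>t. t \<in> T \<Longrightarrow> card {x \<in> U. g x = t} = n"
  shows "card U = card T * n"
proof -
  have "card U = (\<Sum>t\<in>T. card {x \<in> U. g x = t})"
    using sum.group[OF assms(1-3), of "\<lambda>_. 1 :: nat"] by simp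
  also have "\<dots> = (\<Sum>t\<in>T. n)"
    by (rule sum.cong) (simp_all add: assms(4))
  finally show ?thesis by simp
qed

lemma finite_ext_bij: "finite A \<Longrightarrow> finite B \<Longrightarrow> finite (ext_bij A B)"
proof (rule finite_subset)
  show "ext_bij A B \<subseteq> A \<rightarrow>\<^sub>E B" by (auto simp: ext_bij_def PiE_def bij_betw_def)
qed (simp add: finite_PiE)

lemma finite_bundle_iso:
  assumes "finite (Pieces A)" "finite (Pieces B)" "finite (Facets A)" "finite (Facets B)"
  shows "finite (bundle_iso k A B)"
  by (rule finite_subset[of _ "ext_bij (Pieces A) (Pieces B) \<times> ext_bij (Facets A) (Facets B)"])
    (use assms in \<open>auto simp: bundle_iso_def finite_ext_bij\<close>)

lemma finite_geom_facets: "finite geom_facets"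
proof (rule finite_subset)
  show "geom_facets \<subseteq> cubies \<times> normals" by (auto simp: geom_facets_def)
  show "finite (cubies \<times> normals)"
    by (auto simp: cubies_def normals_def axes_def)
qed

lemma finite_edge_iso: "finite (bundle_iso 2 ArGeom ArMat)"
proof (rule finite_bundle_iso)
  show "finite (Facets ArGeom)"
    using finite_geom_facets by (simp add: edge_facets_def)
  show "finite (Facets ArMat)"
    by (rule finite_subset[of _ "UNIV \<times> {1, 2} \<times> UNIV"]) auto
qed auto

definition unmatched_edges where
  "unmatched_edges = {f \<in> bundle_iso 2 ArGeom ArMat. matched (snd f) = {}}"

lemma card_edge_isos: "card (bundle_iso 2 ArGeom ArMat) = 2 ^ 12 * card unmatched_edges"
proof -
  let ?U = "bundle_iso 2 ArGeom ArMat"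
  have "card {f \<in> ?U. matched (snd f) = S} = card unmatched_edges" if S: "S \<in> Pow colour_pairs" for S
  proof -
    have "bundle_comp ArGeom (flip_first S) f \<in> ?U" if "f \<in> ?U" for f
      by (rule bundle_iso_comp[OF closed_ArGeom that flip_first_iso])
    with S have "bij_betw (bundle_comp ArGeom (flip_first S)) {f \<in> ?U. matched (snd f) = S} unmatched_edges"
      by (intro bij_betwI[where g = "bundle_comp ArGeom (flip_first S)"])
        (auto simp: unmatched_edges_def matched_flip flip_first_involution)
    then show ?thesis by (rule bij_betw_same_card)
  qed
  then have "card ?U = card (Pow colour_pairs) * card unmatched_edges"
    by (intro card_equal_fibres[where g = "\<lambda>f. matched (snd f)"] finite_edge_iso)
      (auto simp: matched_def)
  then show ?thesis by (simp add: card_Pow card_colour_pairs)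
qed


section \<open>Counting corner isomorphisms\<close>

text \<open>
  The total twist of the geometric automorphism that leads from \<open>g\<^sub>0\<close> to \<open>g\<close>.
\<close>

definition relative_twist where
  "relative_twist g\<^sub>0 g = twist (snd (bundle_comp SomGeom (bundle_inv SomGeom SomMat g\<^sub>0) g)) mod 3"

lemma corner_map_iso:
  assumes "f \<in> bundle_iso 3 SomGeom SomGeom"
  shows "corner_map (snd f)"
proof -
  obtain p F where f: "f = (p, F)" by (cases f)
  note f' = bundle_isoD[OF assms[unfolded f]] bundle_iso_mem[OF assms[unfolded f]]
  have "F (spin x) = spin (F x)" if "x \<in> corner_facets" for x
    using f'(6)[of 1 x] that by simp
  with f' show ?thesis by (auto simp: f corner_map_def)
qed

lemma twist_cong:
  assumes "\<And>x. x \<in> corner_facets \<Longrightarrow> b x = b' x"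
  shows "twist b = twist b'"
  unfolding twist_def using assms base_facet_corner(1) by (intro sum.cong) auto

definition spin_one :: "vec \<times> vec \<Rightarrow> vec \<times> vec" where
  "spin_one x = (if fst x = (3, 3, 3) then spin x else x)"

definition spin_one_iso where
  "spin_one_iso = (\<lambda>c\<in>corner_cubies. c, restrict spin_one corner_facets)"

lemma spin_one_iso: "spin_one_iso \<in> bundle_iso 3 SomGeom SomGeom"
proof -
  have "bij_betw spin_one corner_facets corner_facets"
    by (rule bij_betwI[where g = "\<lambda>x. spin_one (spin_one x)"])
      (auto simp: spin_one_def spin_corner)
  moreover have "spin_one ((spin ^^ m) x) = (spin ^^ m) (spin_one x)" for m x
    by (auto simp: spin_one_def funpow_swap1)
  moreover have "fst (spin_one x) = fst x" for x by (simp add: spin_one_def)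
  moreover have "bij_betw (\<lambda>c. c) corner_cubies corner_cubies"
    by (simp add: bij_betw_def)
  ultimately show ?thesis
    by (auto simp: spin_one_iso_def bundle_iso_def ext_bij_def spin_power_corner corner_facets_fst
        cong: bij_betw_cong)
qed

lemma twist_spin_one: "twist (snd spin_one_iso) = 1"
proof -
  have "(3, 3, 3) \<in> corner_cubies" by code_simp
  moreover have "twist_index (snd spin_one_iso (base_facet c)) = (if c = (3,3,3) then 1 else 0)"
    if "c \<in> corner_cubies" for c
    using base_facet_corner[OF that] spin_corner(4)[OF base_facet_corner(1)[OF that]]
    by (auto simp: spin_one_iso_def spin_one_def)
  ultimately show ?thesis
    by (simp add: twist_def cong: sum.cong)
qed

lemma relative_twist_spin_one:
  assumes "g\<^sub>0 \<in> bundle_iso 3 SomGeom SomMat" "g \<in> bundle_iso 3 SomGeom SomMat"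
  shows "relative_twist g\<^sub>0 (bundle_comp SomGeom g spin_one_iso) = (relative_twist g\<^sub>0 g + 1) mod 3"
proof -
  let ?i = "bundle_inv SomGeom SomMat g\<^sub>0"
  let ?h = "bundle_comp SomGeom ?i g"
  have h: "?h \<in> bundle_iso 3 SomGeom SomGeom"
    by (rule bundle_iso_comp[OF closed_SomGeom assms(2) bundle_iso_inv[OF closed_SomGeom assms(1)]])
  obtain sp SP where s: "spin_one_iso = (sp, SP)" by (cases spin_one_iso)
  note s' = bundle_iso_mem(2)[OF spin_one_iso[unfolded s], simplified]
  have "twist (snd (bundle_comp SomGeom ?i (bundle_comp SomGeom g spin_one_iso)))
    = twist (snd ?h \<circ> snd spin_one_iso)"
    by (rule twist_cong) (simp add: bundle_comp_def compose_def s s')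
  also have "\<dots> mod 3 = (twist (snd ?h) + 1) mod 3"
    using corner_map_comp(2)[OF corner_map_iso[OF h] corner_map_iso[OF spin_one_iso]]
    by (simp add: twist_spin_one)
  finally show ?thesis by (simp add: relative_twist_def mod_simps)
qed

definition untwisted_corners where
  "untwisted_corners g\<^sub>0 = {g \<in> bundle_iso 3 SomGeom SomMat. relative_twist g\<^sub>0 g = 0}"

lemma finite_corner_iso: "finite (bundle_iso 3 SomGeom SomMat)"
proof (rule finite_bundle_iso)
  show "finite (Facets SomGeom)"
    using finite_geom_facets by (simp add: corner_facets_def)
  show "finite (Facets SomMat)"
    by (rule finite_subset[of _ "UNIV \<times> UNIV"]) (simp, simp del: UNIV_Times_UNIV)
qed (auto simp: SomMat_def)

text \<open>
  Spinning one corner injects each fibre of \<open>relative_twist\<close> into the next one, cyclically, so all three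
  fibres have the same size.
\<close>

lemma card_corner_isos:
  assumes g0: "g\<^sub>0 \<in> bundle_iso 3 SomGeom SomMat"
  shows "card (bundle_iso 3 SomGeom SomMat) = 3 * card (untwisted_corners g\<^sub>0)"
proof -
  let ?U = "bundle_iso 3 SomGeom SomMat"
  let ?s = "\<lambda>g. bundle_comp SomGeom g spin_one_iso"
  define fib where "fib t = {g \<in> ?U. relative_twist g\<^sub>0 g = t}" for t
  have s: "?s g \<in> ?U" if "g \<in> ?U" for g
    by (rule bundle_iso_comp[OF closed_SomGeom spin_one_iso that])
  have sss: "?s (?s (?s g)) = g" if "g \<in> ?U" for g
  proof -
    obtain p G where g: "g = (p, G)" by (cases g)
    note g' = bundle_isoD(1,3)[OF that[unfolded g]]
    show ?thesis
      using g' by (auto simp: g bundle_comp_def spin_one_iso_def compose_def extensional_def fun_eq_iff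
          spin_one_def spin_corner)
  qed
  have le: "card (fib t) \<le> card (fib ((t + 1) mod 3))" for t
  proof (rule card_inj_on_le[where f = ?s])
    show "inj_on ?s (fib t)"
      by (rule inj_on_inverseI[where g = "\<lambda>g. ?s (?s g)"]) (simp add: fib_def sss)
    show "?s ` fib t \<subseteq> fib ((t + 1) mod 3)"
      using s g0 by (auto simp: fib_def relative_twist_spin_one)
    show "finite (fib ((t + 1) mod 3))"
      using finite_corner_iso by (simp add: fib_def)
  qed
  have "(0 + 1) mod 3 = (1 :: nat)" "(1 + 1) mod 3 = (2 :: nat)" "(2 + 1) mod 3 = (0 :: nat)"
    by simp_all
  with le[of 0] le[of 1] le[of 2]
  have "card (fib 0) \<le> card (fib 1)" "card (fib 1) \<le> card (fib 2)" "card (fib 2) \<le> card (fib 0)"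
    by metis+
  then have eq: "card (fib t) = card (fib 0)" if "t \<in> {0, 1, 2}" for t
    using that by auto
  have "card ?U = card {0, 1, 2 :: nat} * card (fib 0)"
  proof (rule card_equal_fibres[where g = "relative_twist g\<^sub>0"])
    have mod_3: "n mod 3 \<in> {0, 1, 2}" for n :: nat
      unfolding insert_iff empty_iff by presburger
    show "relative_twist g\<^sub>0 ` ?U \<subseteq> {0, 1, 2}"
      by (rule image_subsetI) (unfold relative_twist_def, rule mod_3)
    show "card {g \<in> ?U. relative_twist g\<^sub>0 g = t} = card (fib 0)" if "t \<in> {0, 1, 2}" for t
      using eq[OF that] by (simp only: fib_def)
  qed (simp_all add: finite_corner_iso)
  then show ?thesis by (simp add: untwisted_corners_def fib_def)
qed


section \<open>The solvable states\<close>

abbreviation on_edges where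
  "on_edges w \<equiv> (restrict (run_piece w) edge_cubies, restrict (run_facet w) edge_facets)"

abbreviation on_corners where
  "on_corners w \<equiv> (restrict (run_piece w) corner_cubies, restrict (run_facet w) corner_facets)"

text \<open>
  What remains of a material edge facet when the two edges with the same colour pair are identified.
\<close>

definition mark :: "colour set \<times> nat \<times> colour \<Rightarrow> colour set \<times> colour" where
  "mark = (\<lambda>(P, j, a). (P, a))"

lemma positive_subset: "positive_facets \<subseteq> edge_facets"
  by (auto simp: positive_facets_def)

lemma fst_positive: "bij_betw fst positive_facets edge_cubies"
  unfolding bij_betw_def
proof
  show "inj_on fst positive_facets"
  proof (rule inj_onI)
    fix x y assume xy: "x \<in> positive_facets" "y \<in> positive_facets" "fst x = fst y"
    then have "x \<in> edge_facets" "y \<in> edge_facets" using positive_subset by auto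
    from ArGeom_gen(6)[OF this] xy(3) positive_or_gen[OF \<open>x \<in> edge_facets\<close>] xy(1,2)
    show "x = y" by metis
  qed
  show "fst ` positive_facets = edge_cubies"
  proof
    show "fst ` positive_facets \<subseteq> edge_cubies"
      by (auto simp: positive_facets_def edge_facets_def)
    show "edge_cubies \<subseteq> fst ` positive_facets"
    proof
      fix c assume c: "c \<in> edge_cubies"
      from bspec[OF edge_has_opposite_chiralities c]
      obtain n1 n2 where n: "{a\<in>normals. dot c a = 3} = {n1, n2}" "chirality (c, n1) = 24"
        by (elim bexE conjE) rule
      then have "n1 \<in> normals" "dot c n1 = 3" by blast+
      with c n(2) have "(c, n1) \<in> positive_facets"
        by (simp add: positive_facets_def edge_facets_def geom_facets_def edge_cubies_def)
      then show "c \<in> fst ` positive_facets" by (rule image_eqI[rotated]) simp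
    qed
  qed
qed

text \<open>
  Injectivity is the absence of matched pairs; surjectivity follows because each of the two edges of a
  pair contributes one of the two colours.
\<close>

lemma mark_bij:
  assumes "f \<in> unmatched_edges"
  shows "bij_betw (mark \<circ> snd f) positive_facets {(P, a). P \<in> colour_pairs \<and> a \<in> P}"
proof -
  obtain fp F where f: "f = (fp, F)" by (cases f)
  have iso: "(fp, F) \<in> bundle_iso 2 ArGeom ArMat" and m: "matched F = {}"
    using assms by (auto simp: unmatched_edges_def f)
  note F = bundle_isoD[OF iso] bundle_iso_mem(2)[OF iso]
  define I where "I = F ` positive_facets"
  have I: "I \<subseteq> Facets ArMat" using F(7) positive_subset by (auto simp: I_def simp del: ArMat_simps(2))
  have no: "\<not> ((P, 1, a) \<in> I \<and> (P, 2, a) \<in> I)" if "P \<in> colour_pairs" "a \<in> P" for P a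
    using m that unfolding matched_def I_def by blast
  have same: "j = j'" if "(P, j, a) \<in> I" "(P, j', a) \<in> I" for P j j' a
  proof -
    have "P \<in> colour_pairs" "a \<in> P" "j \<in> {1, 2}" "j' \<in> {1, 2}" using that I by auto
    with that no[of P a] show ?thesis by auto
  qed
  have inj_F: "inj_on F positive_facets"
    using F(4) positive_subset by (auto simp: bij_betw_def intro: inj_on_subset)
  have inj: "inj_on mark I"
    using same by (auto simp: inj_on_def mark_def)
  have "mark ` I = {(P, a). P \<in> colour_pairs \<and> a \<in> P}"
  proof
    show "mark ` I \<subseteq> {(P, a). P \<in> colour_pairs \<and> a \<in> P}"
      using I by (auto simp: mark_def)
    show "{(P, a). P \<in> colour_pairs \<and> a \<in> P} \<subseteq> mark ` I"
    proof clarify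
      fix P a assume P: "P \<in> colour_pairs" "a \<in> P"
      obtain b where b: "P = {a, b}" using colour_pair_cases[OF P] .
      have u: "(P, j, a) \<in> I \<longleftrightarrow> (P, j, b) \<notin> I" if "j \<in> {1, 2}" for j
        using positive_image[OF iso, of "(P, j, a)"] ArMat_gen(1)[OF P(1) b that] P that
        by (simp add: I_def)
      have "b \<in> P" using b by simp
      from no[OF P(1) this] u[of 1] u[of 2] have "(P, 1, a) \<in> I \<or> (P, 2, a) \<in> I" by auto
      then show "(P, a) \<in> mark ` I" by (force simp: mark_def)
    qed
  qed
  with inj have "bij_betw mark I {(P, a). P \<in> colour_pairs \<and> a \<in> P}"
    by (simp add: bij_betw_def)
  moreover have "bij_betw F positive_facets I"
    using inj_F by (simp add: I_def bij_betw_def)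
  ultimately show ?thesis by (simp add: f bij_betw_trans)
qed

lemma edge_normals_determine:
  "\<forall>c\<in>edge_cubies. \<forall>n\<in>normals. dot c n = 3 \<longrightarrow> (\<forall>m\<in>normals. dot c m = 3 \<longrightarrow> n \<noteq> m \<longrightarrow>
    (\<forall>d\<in>edge_cubies. dot d n = 3 \<longrightarrow> dot d m = 3 \<longrightarrow> chirality (c, n) = chirality (d, n) \<longrightarrow> c = d))"
  by code_simp

lemma col_inj: "\<forall>n\<in>normals. \<forall>m\<in>normals. col n = col m \<longrightarrow> n = m"
  by code_simp

text \<open>
  If the two edges of a pair had the same colours on their positive facets, they would sit between the
  same two faces of the solved cube with the same chirality, hence at the same place.
\<close>

lemma solved_unmatched:
  assumes "solved_state (f, g, h)"
  shows "f \<in> unmatched_edges"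
proof -
  obtain fp F where f: "f = (fp, F)" by (cases f)
  obtain gp G where g: "g = (gp, G)" by (cases g)
  have iso: "(fp, F) \<in> bundle_iso 2 ArGeom ArMat"
    using assms by (simp add: solved_state_def Rev_marq_def f)
  note F = bundle_isoD[OF iso] bundle_iso_mem(2)[OF iso]
  have col: "snd (snd (F x)) = col (snd x)" if "x \<in> edge_facets" for x
    using assms that unfolding solved_state_def f g by (cases x) auto
  have "P \<notin> matched F" for P
  proof
    assume "P \<in> matched F"
    then obtain a x y where P: "P \<in> colour_pairs" "a \<in> P"
      and x: "x \<in> positive_facets" "F x = (P, 1, a)" and y: "y \<in> positive_facets" "F y = (P, 2, a)"
      by (auto simp: matched_def)
    have e: "x \<in> edge_facets" "y \<in> edge_facets" using x y positive_subset by auto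
    obtain b where b: "P = {a, b}" using colour_pair_cases[OF P] .
    have gF: "F (gen ArGeom z) = gen ArMat (F z)" if "z \<in> edge_facets" for z
      using F(6)[of 1 z] that by simp
    have gx: "F (gen ArGeom x) = (P, 1, b)" "F (gen ArGeom y) = (P, 2, b)"
      using gF[OF e(1)] gF[OF e(2)] x y ArMat_gen(1)[OF P(1) b] by auto
    note ge = ArGeom_gen(1,2,3)[OF e(1)] ArGeom_gen(1,2)[OF e(2)]
    have nrm: "snd z \<in> normals" "dot (fst z) (snd z) = 3" "fst z \<in> edge_cubies" if "z \<in> edge_facets" for z
      using that by (auto simp: edge_facets_def geom_facets_def)
    have "col (snd x) = col (snd y)" using col[OF e(1)] col[OF e(2)] x y by simp
    with col_inj nrm e have n: "snd y = snd x" by metis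
    have "col (snd (gen ArGeom x)) = col (snd (gen ArGeom y))"
      using col[OF ge(1)] col[OF ge(4)] gx by simp
    with col_inj nrm ge have m: "snd (gen ArGeom y) = snd (gen ArGeom x)" by metis
    have ne: "snd x \<noteq> snd (gen ArGeom x)" using ge(2,3) by (auto simp: prod_eq_iff)
    have dots: "dot (fst x) (snd x) = 3" "dot (fst x) (snd (gen ArGeom x)) = 3"
      "dot (fst y) (snd x) = 3" "dot (fst y) (snd (gen ArGeom x)) = 3"
      using nrm(2)[OF e(1)] nrm(2)[OF e(2)] nrm(2)[OF ge(1)] nrm(2)[OF ge(4)] ge(2,5) n m by simp_all
    have chi: "chirality (fst x, snd x) = chirality (fst y, snd x)"
      using x(1) y(1) n by (metis (mono_tags, lifting) mem_Collect_eq positive_facets_def prod.collapse)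
    have "fst x = fst y"
      using edge_normals_determine nrm(3)[OF e(1)] nrm(1)[OF e(1)] dots(1) nrm(1)[OF ge(1)] dots(2) ne
        nrm(3)[OF e(2)] dots(3,4) chi by blast
    then have "proj ArMat (F x) = proj ArMat (F y)"
      using F(5) e by simp
    then show False using x y by simp
  qed
  with iso show ?thesis by (auto simp: unmatched_edges_def f)
qed

lemma indist_edges_preserve:
  "indist_edges = {i \<in> bundle_iso 2 ArMat ArMat. \<forall>y\<in>Facets ArMat. mark (snd i y) = mark y}"
proof -
  have pt: "(\<exists>j'. z = (P, j', a)) \<longleftrightarrow> mark z = mark (P, j, a)" for z P j a
    by (cases z) (auto simp: mark_def)
  have "(\<forall>(P, j, a)\<in>S. \<exists>j'. F (P, j, a) = (P, j', a)) \<longleftrightarrow> (\<forall>y\<in>S. mark (F y) = mark y)"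
    for F :: "colour set \<times> nat \<times> colour \<Rightarrow> colour set \<times> nat \<times> colour" and S
  proof (rule ball_cong[OF refl])
    fix y :: "colour set \<times> nat \<times> colour"
    obtain P j a where "y = (P, j, a)" by (cases y)
    then show "(case y of (P, j, a) \<Rightarrow> \<exists>j'. F (P, j, a) = (P, j', a)) \<longleftrightarrow> mark (F y) = mark y"
      by (simp add: pt)
  qed
  then show ?thesis
    unfolding indist_edges_def carrier_bundle_Aut by auto
qed

text \<open>
  Composing one marking with the inverse of the other gives a permutation of the facets of positive
  chirality, that is, of the edge cubies. A word that realizes it makes the two colourings agree up to
  the index of the edge in its pair, first on the positive facets and then, passing to the other facet
  of each edge, on all of them.
\<close>

lemma edges_solvable:
  assumes f0: "f\<^sub>0 \<in> unmatched_edges" and f: "f \<in> unmatched_edges"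
  obtains p where "p permutes edge_cubies"
    "\<And>w. valid w \<Longrightarrow> (\<And>c. c \<in> edge_cubies \<Longrightarrow> run_piece w c = p c) \<Longrightarrow>
       \<exists>i\<in>indist_edges. bundle_comp ArGeom i (bundle_comp ArGeom f\<^sub>0 (on_edges w)) = f"
proof -
  let ?D = "{(P, a). P \<in> colour_pairs \<and> a \<in> P}"
  define q0 q where "q0 = mark \<circ> snd f\<^sub>0" and "q = mark \<circ> snd f"
  have q0: "bij_betw q0 positive_facets ?D" and q: "bij_betw q positive_facets ?D"
    using mark_bij[OF f0] mark_bij[OF f] by (simp_all add: q0_def q_def)
  define r where "r = inv_into positive_facets q0 \<circ> q"
  have r: "bij_betw r positive_facets positive_facets"
    unfolding r_def by (rule bij_betw_trans[OF q bij_betw_inv_into[OF q0]])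
  have q0r: "q0 (r x) = q x" if "x \<in> positive_facets" for x
  proof -
    have "q x \<in> q ` positive_facets" using that by (rule imageI)
    also have "q ` positive_facets = q0 ` positive_facets" using q q0 by (simp add: bij_betw_def)
    finally have "q x \<in> q0 ` positive_facets" .
    then show ?thesis by (simp add: r_def f_inv_into_f)
  qed
  define p where "p = fst \<circ> r \<circ> inv_into positive_facets fst"
  have p: "bij_betw p edge_cubies edge_cubies"
    unfolding p_def by (intro bij_betw_trans[OF bij_betw_inv_into[OF fst_positive]] bij_betw_trans[OF r] fst_positive)
  have pr: "p (fst x) = fst (r x)" if "x \<in> positive_facets" for x
    using that fst_positive by (simp add: p_def bij_betw_def)
  have iso: "f \<in> bundle_iso 2 ArGeom ArMat" "f\<^sub>0 \<in> bundle_iso 2 ArGeom ArMat"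
    using f f0 by (auto simp: unmatched_edges_def)
  show thesis
  proof
    show "(\<lambda>c. if c \<in> edge_cubies then p c else c) permutes edge_cubies"
      by (rule bij_imp_permutes) (use p in \<open>auto cong: bij_betw_cong\<close>)
    fix w assume w: "valid w"
      and wp: "\<And>c. c \<in> edge_cubies \<Longrightarrow> run_piece w c = (if c \<in> edge_cubies then p c else c)"
    have pos_w: "run_facet w x \<in> positive_facets" if "x \<in> positive_facets" for x
      using that run_facet_kind(3)[OF w] run_chirality[OF w] by (auto simp: positive_facets_def)
    have w_r: "run_facet w x = r x" if x: "x \<in> positive_facets" for x
    proof -
      have "fst x \<in> edge_cubies" using x by (auto simp: positive_facets_def edge_facets_def)
      then have "fst (run_facet w x) = fst (r x)" using wp pr[OF x] by simp
      moreover have "r x \<in> positive_facets" using r x by (auto simp: bij_betw_def)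
      ultimately show ?thesis
        using fst_positive pos_w[OF x] by (auto simp: bij_betw_def inj_on_def)
    qed
    let ?f1 = "bundle_comp ArGeom f\<^sub>0 (on_edges w)"
    have f1: "?f1 \<in> bundle_iso 2 ArGeom ArMat"
      by (rule bundle_iso_comp[OF closed_ArGeom transf_edges[OF w] iso(2)])
    obtain i where i: "i \<in> bundle_iso 2 ArMat ArMat" "bundle_comp ArGeom i ?f1 = f"
      using bundle_iso_right_quotient[OF closed_ArGeom closed_ArMat iso(1) f1] by blast
    obtain ip iF where ii: "i = (ip, iF)" by (cases i)
    obtain f1p F1 where f1': "?f1 = (f1p, F1)" by (cases ?f1)
    obtain fp F where f': "f = (fp, F)" by (cases f)
    note F1 = bundle_isoD[OF f1[unfolded f1']] bundle_iso_mem(2)[OF f1[unfolded f1']]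
    note F = bundle_isoD[OF iso(1)[unfolded f']] bundle_iso_mem(2)[OF iso(1)[unfolded f']]
    have iF: "iF (F1 x) = F x" if "x \<in> edge_facets" for x
      using arg_cong[OF i(2)[unfolded f1' ii f'], of "\<lambda>h. snd h x"] that
      by (simp add: bundle_comp_def compose_def)
    have F1_val: "F1 x = snd f\<^sub>0 (run_facet w x)" if "x \<in> edge_facets" for x
      using that arg_cong[OF f1', of snd] by (auto simp: bundle_comp_def compose_def)
    have mk: "mark (F1 x) = mark (F x)" if "x \<in> positive_facets" for x
      using F1_val[OF subsetD[OF positive_subset that]] q0r[OF that] w_r[OF that]
      by (simp add: q0_def q_def f')
    have mk_gen: "mark (gen ArMat y) = mark (gen ArMat z)" if yz: "mark y = mark z" "y \<in> Facets ArMat" "z \<in> Facets ArMat" for y z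
    proof -
      obtain P j a k where y: "y = (P, j, a)" and z: "z = (P, k, a)"
        using yz(1) by (cases y; cases z) (auto simp: mark_def)
      have P: "P \<in> colour_pairs" "a \<in> P" "j \<in> {1, 2}" "k \<in> {1, 2}" using yz by (auto simp: y z)
      obtain b where "P = {a, b}" using colour_pair_cases[OF P(1,2)] .
      from ArMat_gen(1)[OF P(1) this P(3)] ArMat_gen(1)[OF P(1) this P(4)]
      show ?thesis by (simp add: y z mark_def)
    qed
    have mk_all: "mark (F1 x) = mark (F x)" if x: "x \<in> edge_facets" for x
    proof (cases "x \<in> positive_facets")
      case False
      let ?y = "gen ArGeom x"
      have y: "?y \<in> positive_facets" "?y \<in> edge_facets" "gen ArGeom ?y = x"
        using positive_or_gen[OF x] False ArGeom_gen(1)[OF x] twofold_gen_gen[OF twofold_ArGeom, of x] x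
        by auto
      have "F1 x = gen ArMat (F1 ?y)" "F x = gen ArMat (F ?y)"
        using F1(6)[of 1 ?y] F(6)[of 1 ?y] y by simp_all
      with mk_gen[OF mk[OF y(1)]] F1(7) F(7) y(2) show ?thesis by simp
    qed (rule mk)
    have "mark (iF y) = mark y" if "y \<in> Facets ArMat" for y
    proof -
      have "y \<in> F1 ` edge_facets" using F1(4) that by (simp add: bij_betw_def del: ArMat_simps(2))
      then show ?thesis using iF mk_all by auto
    qed
    then have "i \<in> indist_edges"
      using i(1) by (simp add: indist_edges_preserve ii del: ArMat_simps(2))
    with i(2) show "\<exists>i\<in>indist_edges. bundle_comp ArGeom i ?f1 = f" by blast
  qed
qed

text \<open>
  Words permute the positive facets and \<open>indist_edges\<close> preserves marks, so a matched pair would already be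
  matched in \<open>f\<^sub>0\<close>.
\<close>

lemma edges_remain_unmatched:
  assumes f0: "f\<^sub>0 \<in> unmatched_edges" and w: "valid w" and i: "i \<in> indist_edges"
  shows "bundle_comp ArGeom i (bundle_comp ArGeom f\<^sub>0 (on_edges w)) \<in> unmatched_edges"
proof -
  let ?f = "bundle_comp ArGeom i (bundle_comp ArGeom f\<^sub>0 (on_edges w))"
  have i': "i \<in> bundle_iso 2 ArMat ArMat" "\<And>y. y \<in> Facets ArMat \<Longrightarrow> mark (snd i y) = mark y"
    using i by (auto simp: indist_edges_preserve simp del: ArMat_simps(2))
  have f0': "f\<^sub>0 \<in> bundle_iso 2 ArGeom ArMat" "matched (snd f\<^sub>0) = {}"
    using f0 by (auto simp: unmatched_edges_def)
  have f: "?f \<in> bundle_iso 2 ArGeom ArMat"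
    by (rule bundle_iso_comp[OF closed_ArGeom bundle_iso_comp[OF closed_ArGeom transf_edges[OF w] f0'(1)] i'(1)])
  obtain f0p F0 where f0'': "f\<^sub>0 = (f0p, F0)" by (cases "f\<^sub>0")
  obtain ip iF where ii: "i = (ip, iF)" by (cases i)
  note F0 = bundle_iso_mem(2)[OF f0'(1)[unfolded f0'']]
  have pos_w: "run_facet w x \<in> positive_facets" if "x \<in> positive_facets" for x
    using that run_facet_kind(3)[OF w] run_chirality[OF w] by (auto simp: positive_facets_def)
  have val: "snd ?f x = iF (F0 (run_facet w x))" if "x \<in> positive_facets" for x
    using that positive_subset by (auto simp: bundle_comp_def compose_def f0'' ii)
  have img: "\<exists>z\<in>F0 ` positive_facets. y = iF z \<and> mark z = mark y \<and> z \<in> Facets ArMat"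
    if y: "y \<in> snd ?f ` positive_facets" for y
  proof -
    obtain x where x: "x \<in> positive_facets" "y = iF (F0 (run_facet w x))" using y val by auto
    have "F0 (run_facet w x) \<in> Facets ArMat"
      by (rule F0) (use pos_w[OF x(1)] positive_subset in auto)
    with x pos_w[OF x(1)] i'(2) show ?thesis unfolding ii by auto
  qed
  have source: "\<exists>j\<in>{1, 2}. (P, j, a) \<in> F0 ` positive_facets \<and> iF (P, j, a) = (P, m, a)"
    if y: "(P, m, a) \<in> snd ?f ` positive_facets" for P m a
  proof -
    obtain z where z: "z \<in> F0 ` positive_facets" "(P, m, a) = iF z" "mark z = mark (P, m, a)"
      "z \<in> Facets ArMat"
      using img[OF y] by blast
    obtain Q j b where Q: "z = (Q, j, b)" by (cases z)
    have "Q = P" "b = a" using z(3) by (simp_all add: Q mark_def)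
    moreover have "j \<in> {1, 2}" using z(4) by (simp add: Q)
    ultimately show ?thesis using z(1,2) unfolding Q by (intro bexI[of _ j]) simp_all
  qed
  have "P \<notin> matched (snd ?f)" for P
  proof
    assume "P \<in> matched (snd ?f)"
    then obtain a where a: "P \<in> colour_pairs" "a \<in> P"
      "(P, 1, a) \<in> snd ?f ` positive_facets" "(P, 2, a) \<in> snd ?f ` positive_facets"
      by (auto simp: matched_def)
    from source[OF a(3)] obtain j
      where j: "(P, j, a) \<in> F0 ` positive_facets" "iF (P, j, a) = (P, 1, a)" "j \<in> {1, 2}"
      by blast
    from source[OF a(4)] obtain k
      where k: "(P, k, a) \<in> F0 ` positive_facets" "iF (P, k, a) = (P, 2, a)" "k \<in> {1, 2}"
      by blast
    have "j \<noteq> k" using j(2) k(2) by auto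
    then have "(P, 1, a) \<in> F0 ` positive_facets \<and> (P, 2, a) \<in> F0 ` positive_facets"
      using j(1,3) k(1,3) by blast
    then have "P \<in> matched F0" using a(1,2) unfolding matched_def by blast
    then show False using f0'(2) by (simp add: f0'')
  qed
  with f show ?thesis by (auto simp: unmatched_edges_def)
qed

lemma SomMat_one_left:
  assumes "g \<in> bundle_iso 3 SomGeom SomMat"
  shows "bundle_comp SomGeom \<one>\<^bsub>bundle_Aut 3 SomMat\<^esub> g = g"
proof -
  obtain gp G where g: "g = (gp, G)" by (cases g)
  note g' = bundle_isoD[OF assms[unfolded g]] bundle_iso_mem[OF assms[unfolded g]]
  show ?thesis
    using g'(1,3,7,8) by (auto simp: g bundle_comp_def compose_def extensional_def fun_eq_iff)
qed

lemma bundle_iso_facets_determine: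
  assumes "f \<in> bundle_iso k A B" "f' \<in> bundle_iso k A B" "proj A ` Facets A = Pieces A"
    and eq: "\<And>x. x \<in> Facets A \<Longrightarrow> snd f x = snd f' x"
  shows "f = f'"
proof -
  obtain p F p' F' where f: "f = (p, F)" "f' = (p', F')" by (cases f; cases f')
  note 1 = bundle_isoD[OF assms(1)[unfolded f]] and 2 = bundle_isoD[OF assms(2)[unfolded f]]
  have "F = F'"
    using 1(3) 2(3) eq by (intro extensionalityI[of F "Facets A"]) (auto simp: f)
  moreover have "p = p'"
  proof (rule extensionalityI[OF 1(1) 2(1)])
    fix c assume "c \<in> Pieces A"
    then obtain x where "x \<in> Facets A" "c = proj A x" using assms(3) by blast
    with 1(5) 2(5) \<open>F = F'\<close> show "p c = p' c" by metis
  qed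
  ultimately show ?thesis by (simp add: f)
qed

lemma corners_solvable:
  assumes g0: "g\<^sub>0 \<in> bundle_iso 3 SomGeom SomMat" and g: "g \<in> untwisted_corners g\<^sub>0"
  obtains b where "corner_map b" "twist b mod 3 = 0"
    "\<And>w. valid w \<Longrightarrow> (\<And>x. x \<in> corner_facets \<Longrightarrow> run_facet w x = b x) \<Longrightarrow>
      bundle_comp SomGeom g\<^sub>0 (on_corners w) = g"
proof
  let ?b = "bundle_comp SomGeom (bundle_inv SomGeom SomMat g\<^sub>0) g"
  have g': "g \<in> bundle_iso 3 SomGeom SomMat" using g by (simp add: untwisted_corners_def)
  have "?b \<in> bundle_iso 3 SomGeom SomGeom"
    by (rule bundle_iso_comp[OF closed_SomGeom g' bundle_iso_inv[OF closed_SomGeom g0]])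
  then show "corner_map (snd ?b)" by (rule corner_map_iso)
  show "twist (snd ?b) mod 3 = 0"
    using g by (simp add: untwisted_corners_def relative_twist_def)
  fix w assume w: "valid w" and wb: "\<And>x. x \<in> corner_facets \<Longrightarrow> run_facet w x = snd ?b x"
  show "bundle_comp SomGeom g\<^sub>0 (on_corners w) = g"
  proof (rule bundle_iso_facets_determine)
    show "bundle_comp SomGeom g\<^sub>0 (on_corners w) \<in> bundle_iso 3 SomGeom SomMat"
      by (rule bundle_iso_comp[OF closed_SomGeom transf_corners[OF w] g0])
    show "g \<in> bundle_iso 3 SomGeom SomMat" by fact
    show "proj SomGeom ` Facets SomGeom = Pieces SomGeom"
      using corner_facets_fst base_facet_corner(1) by (auto intro!: image_eqI[of _ fst "base_facet _"])
    fix x assume x: "x \<in> Facets SomGeom"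
    obtain p0 G0 p G where [simp]: "g\<^sub>0 = (p0, G0)" "g = (p, G)" by (cases "g\<^sub>0"; cases g)
    have "G x \<in> Facets SomMat" using bundle_iso_mem(2)[OF g'[simplified]] x by simp
    moreover have "G0 ` corner_facets = Facets SomMat"
      using bundle_isoD(4)[OF g0[simplified]] by (simp add: bij_betw_def)
    ultimately show "snd (bundle_comp SomGeom g\<^sub>0 (on_corners w)) x = snd g x"
      using wb x by (simp add: bundle_comp_def bundle_inv_def compose_def f_inv_into_f)
  qed
qed

lemma corners_remain_untwisted:
  assumes g0: "g\<^sub>0 \<in> bundle_iso 3 SomGeom SomMat" and w: "valid w"
  shows "bundle_comp SomGeom g\<^sub>0 (on_corners w) \<in> untwisted_corners g\<^sub>0"
proof -
  obtain p0 G0 where [simp]: "g\<^sub>0 = (p0, G0)" by (cases "g\<^sub>0")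
  note G0 = bundle_isoD(4)[OF g0[simplified]] bundle_iso_mem(2)[OF g0[simplified]]
  let ?g = "bundle_comp SomGeom g\<^sub>0 (on_corners w)"
  have "snd (bundle_comp SomGeom (bundle_inv SomGeom SomMat g\<^sub>0) ?g) x = run_facet w x"
    if x: "x \<in> corner_facets" for x
    using x run_facet_kind(2)[OF w x] G0 by (simp add: bundle_comp_def bundle_inv_def compose_def bij_betw_def)
  then have "relative_twist g\<^sub>0 ?g = twist (run_facet w) mod 3"
    unfolding relative_twist_def by (metis twist_cong)
  with corner_map_run(2)[OF w] bundle_iso_comp[OF closed_SomGeom transf_corners[OF w] g0]
  show ?thesis by (simp add: untwisted_corners_def)
qed

text \<open>
  In either case the difference is \<open>t\<close>, the identity or the exchange of two centres, transported to the
  material centres by \<open>h\<^sub>0\<close>. It preserves colours because \<open>h\<^sub>0\<close> gives the two centres the same colour.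
\<close>

lemma centres_solvable:
  assumes h0: "h\<^sub>0 \<in> ext_bij CentGeom CentMat" and h: "h \<in> ext_bij CentGeom CentMat"
    and col: "fst (h\<^sub>0 (-1,-1,3)) = fst (h\<^sub>0 (-1,1,3))"
  obtains s where "s permutes CentGeom"
    "\<And>w. valid w \<Longrightarrow> (\<forall>c\<in>CentGeom. run_piece w c = s c) \<or>
        (\<forall>c\<in>CentGeom. run_piece w c = swap (-1,-1,3) (-1,1,3) (s c)) \<Longrightarrow>
      \<exists>i\<in>indist_centres. compose CentGeom i (compose CentGeom h\<^sub>0 (restrict (run_piece w) CentGeom)) = h"
proof
  have b0: "bij_betw h\<^sub>0 CentGeom CentMat" and b: "bij_betw h CentGeom CentMat"
    and ext: "h \<in> extensional CentGeom"
    using h0 h by (simp_all add: ext_bij_def)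
  define k where "k = inv_into CentGeom h\<^sub>0"
  have k: "bij_betw k CentMat CentGeom" unfolding k_def by (rule bij_betw_inv_into[OF b0])
  have kh: "k (h\<^sub>0 c) = c" if "c \<in> CentGeom" for c
    using that b0 by (simp add: k_def bij_betw_def)
  have hk: "h\<^sub>0 (k y) = y" "k y \<in> CentGeom" if "y \<in> CentMat" for y
    using that b0 k by (auto simp: k_def bij_betw_def f_inv_into_f)
  let ?s = "\<lambda>c. if c \<in> CentGeom then k (h c) else c"
  have "bij_betw (k \<circ> h) CentGeom CentGeom" using b k by (rule bij_betw_trans)
  then show "?s permutes CentGeom"
    by (intro bij_imp_permutes) (auto cong: bij_betw_cong)
  fix w assume w: "valid w" and ws: "(\<forall>c\<in>CentGeom. run_piece w c = ?s c) \<or>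
        (\<forall>c\<in>CentGeom. run_piece w c = swap (-1,-1,3) (-1,1,3) (?s c))"
  have "{(-1,-1,3), (-1,1,3)} \<subseteq> CentGeom" by code_simp
  then have sw: "swap (-1,-1,3) (-1,1,3) permutes CentGeom"
    by (intro permutes_swap_id) auto
  obtain t where t: "t \<in> {id, swap (-1,-1,3) (-1,1,3)}" "\<And>c. c \<in> CentGeom \<Longrightarrow> run_piece w c = t (k (h c))"
    using ws by (force split: if_splits)
  have tp: "t permutes CentGeom" using t(1) sw by (auto simp: permutes_id)
  have tt: "t (t c) = c" for c using t(1) by auto
  have tc: "fst (h\<^sub>0 (t c)) = fst (h\<^sub>0 c)" for c
    using t(1) col by (auto simp: Transposition.transpose_def)
  let ?i = "restrict (\<lambda>y. h\<^sub>0 (t (k y))) CentMat"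
  have "bij_betw (h\<^sub>0 \<circ> (t \<circ> k)) CentMat CentMat"
    by (intro bij_betw_trans[OF _ b0] bij_betw_trans[OF k] permutes_imp_bij[OF tp])
  then have "bij_betw ?i CentMat CentMat" by (simp add: comp_def cong: bij_betw_cong)
  then have "?i \<in> indist_centres"
    using tc hk by (auto simp: indist_centres_def ext_bij_def)
  moreover have "compose CentGeom ?i (compose CentGeom h\<^sub>0 (restrict (run_piece w) CentGeom)) = h"
  proof (rule extensionalityI[OF _ ext])
    fix c assume c: "c \<in> CentGeom"
    have hc: "h c \<in> CentMat" using b c by (auto simp: bij_betw_def)
    have tk: "t (k (h c)) \<in> CentGeom" using hk(2)[OF hc] permutes_in_image[OF tp] by blast
    then have "h\<^sub>0 (t (k (h c))) \<in> CentMat" using b0 by (auto simp: bij_betw_def)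
    with c tk show "compose CentGeom ?i (compose CentGeom h\<^sub>0 (restrict (run_piece w) CentGeom)) c = h c"
      by (simp add: compose_def t(2) kh tt hk(1)[OF hc])
  qed simp
  ultimately show "\<exists>i\<in>indist_centres.
      compose CentGeom i (compose CentGeom h\<^sub>0 (restrict (run_piece w) CentGeom)) = h" by blast
qed

lemma ext_bij_compose:
  "f \<in> ext_bij A B \<Longrightarrow> g \<in> ext_bij B C \<Longrightarrow> compose A g f \<in> ext_bij A C"
  by (auto simp: ext_bij_def bij_betw_compose)

lemma solvable_states_eq:
  assumes "solved_state (f\<^sub>0, g\<^sub>0, h\<^sub>0)"
  shows "solvable_states (f\<^sub>0, g\<^sub>0, h\<^sub>0) = unmatched_edges \<times> untwisted_corners g\<^sub>0 \<times> ext_bij CentGeom CentMat"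
proof
  have g0: "g\<^sub>0 \<in> bundle_iso 3 SomGeom SomMat" and h0: "h\<^sub>0 \<in> ext_bij CentGeom CentMat"
    using assms by (auto simp: solved_state_def Rev_marq_def)
  have f0: "f\<^sub>0 \<in> unmatched_edges" by (rule solved_unmatched[OF assms])
  have act: "left_act (a, b, s) (right_act (f\<^sub>0, g\<^sub>0, h\<^sub>0) (transf w)) =
    (bundle_comp ArGeom a (bundle_comp ArGeom f\<^sub>0 (on_edges w)),
     bundle_comp SomGeom b (bundle_comp SomGeom g\<^sub>0 (on_corners w)),
     compose CentGeom s (compose CentGeom h\<^sub>0 (restrict (run_piece w) CentGeom)))" for a b s w
    by (simp add: transf_def)
  let ?R = "unmatched_edges \<times> untwisted_corners g\<^sub>0 \<times> ext_bij CentGeom CentMat"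
  show "solvable_states (f\<^sub>0, g\<^sub>0, h\<^sub>0) \<subseteq> ?R"
  proof
    fix x assume "x \<in> solvable_states (f\<^sub>0, g\<^sub>0, h\<^sub>0)"
    then obtain a s w where a: "a \<in> indist_edges" and s: "s \<in> indist_centres" and w: "valid w"
      and x: "x = left_act (a, \<one>\<^bsub>bundle_Aut 3 SomMat\<^esub>, s) (right_act (f\<^sub>0, g\<^sub>0, h\<^sub>0) (transf w))"
      unfolding solvable_states_def legal_moves_eq indist_def by blast
    have g: "bundle_comp SomGeom g\<^sub>0 (on_corners w) \<in> untwisted_corners g\<^sub>0"
      by (rule corners_remain_untwisted[OF g0 w])
    then have "bundle_comp SomGeom g\<^sub>0 (on_corners w) \<in> bundle_iso 3 SomGeom SomMat"
      by (simp add: untwisted_corners_def)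
    moreover have "s \<in> ext_bij CentMat CentMat" using s by (simp add: indist_centres_def)
    ultimately show "x \<in> ?R"
      unfolding x act
      using edges_remain_unmatched[OF f0 w a] g h0 transf_centres[OF w]
      by (simp only: SomMat_one_left mem_Times_iff fst_conv snd_conv) (blast intro: ext_bij_compose)
  qed
  show "?R \<subseteq> solvable_states (f\<^sub>0, g\<^sub>0, h\<^sub>0)"
  proof clarify
    fix f\<^sub>1 f\<^sub>2 g\<^sub>1 g\<^sub>2 h
    assume f: "(f\<^sub>1, f\<^sub>2) \<in> unmatched_edges" and g: "(g\<^sub>1, g\<^sub>2) \<in> untwisted_corners g\<^sub>0"
      and h: "h \<in> ext_bij CentGeom CentMat"
    obtain p where p: "p permutes edge_cubies"
      "\<And>w. valid w \<Longrightarrow> (\<And>c. c \<in> edge_cubies \<Longrightarrow> run_piece w c = p c) \<Longrightarrow>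
       \<exists>i\<in>indist_edges. bundle_comp ArGeom i (bundle_comp ArGeom f\<^sub>0 (on_edges w)) = (f\<^sub>1, f\<^sub>2)"
      using edges_solvable[OF f0 f] by metis
    obtain b where b: "corner_map b" "twist b mod 3 = 0"
      "\<And>w. valid w \<Longrightarrow> (\<And>x. x \<in> corner_facets \<Longrightarrow> run_facet w x = b x) \<Longrightarrow>
      bundle_comp SomGeom g\<^sub>0 (on_corners w) = (g\<^sub>1, g\<^sub>2)"
      using corners_solvable[OF g0 g] by metis
    have "\<forall>c\<in>{(-1,-1,3), (-1,1,3)}. (c, (0,0,1)) \<in> geom_facets \<and> c \<in> CentGeom"
      unfolding geom_facets_def mem_Collect_eq case_prod_conv by code_simp
    then have "fst (h\<^sub>0 (-1,-1,3)) = col (0,0,1)" "fst (h\<^sub>0 (-1,1,3)) = col (0,0,1)"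
      using assms unfolding solved_state_def by (auto split: prod.splits)
    then have col: "fst (h\<^sub>0 (-1,-1,3)) = fst (h\<^sub>0 (-1,1,3))" by simp
    obtain s where s: "s permutes CentGeom"
      "\<And>w. valid w \<Longrightarrow> (\<forall>c\<in>CentGeom. run_piece w c = s c) \<or>
        (\<forall>c\<in>CentGeom. run_piece w c = swap (-1,-1,3) (-1,1,3) (s c)) \<Longrightarrow>
      \<exists>i\<in>indist_centres. compose CentGeom i (compose CentGeom h\<^sub>0 (restrict (run_piece w) CentGeom)) = h"
      using centres_solvable[OF h0 h col] by metis
    obtain w where w: "valid w" "\<And>x. x \<in> corner_facets \<Longrightarrow> run_facet w x = b x"
      "\<And>c. c \<in> edge_cubies \<Longrightarrow> run_piece w c = p c"
      "(\<forall>c\<in>CentGeom. run_piece w c = s c) \<or>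
       (\<forall>c\<in>CentGeom. run_piece w c = swap (-1,-1,3) (-1,1,3) (s c))"
      using word_realizing_configuration[OF b(1,2) p(1) s(1)] by blast
    obtain a where a: "a \<in> indist_edges"
      "bundle_comp ArGeom a (bundle_comp ArGeom f\<^sub>0 (on_edges w)) = (f\<^sub>1, f\<^sub>2)"
      using p(2)[OF w(1,3)] by blast
    obtain i where i: "i \<in> indist_centres"
      "compose CentGeom i (compose CentGeom h\<^sub>0 (restrict (run_piece w) CentGeom)) = h"
      using s(2)[OF w(1,4)] by blast
    have "bundle_comp SomGeom g\<^sub>0 (on_corners w) = (g\<^sub>1, g\<^sub>2)" using b(3)[OF w(1,2)] .
    moreover have "(g\<^sub>1, g\<^sub>2) \<in> bundle_iso 3 SomGeom SomMat"
      using g by (simp add: untwisted_corners_def)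
    ultimately have "((f\<^sub>1, f\<^sub>2), (g\<^sub>1, g\<^sub>2), h)
      = left_act (a, \<one>\<^bsub>bundle_Aut 3 SomMat\<^esub>, i) (right_act (f\<^sub>0, g\<^sub>0, h\<^sub>0) (transf w))"
      unfolding act a(2) i(2) by (simp only: SomMat_one_left)
    moreover have "(a, \<one>\<^bsub>bundle_Aut 3 SomMat\<^esub>, i) \<in> indist"
      using a(1) i(1) by (simp only: indist_def mem_Times_iff fst_conv snd_conv singleton_iff)
    moreover have "transf w \<in> legal_moves" using w(1) by (simp add: legal_moves_eq)
    ultimately show "((f\<^sub>1, f\<^sub>2), (g\<^sub>1, g\<^sub>2), h) \<in> solvable_states (f\<^sub>0, g\<^sub>0, h\<^sub>0)"
      unfolding solvable_states_def by blast
  qed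
qed

theorem mainTheorem2:
  fixes x0 :: colouring
  assumes "solved_state x0"
  shows "measure_pmf.prob (pmf_of_set Rev_marq) (solvable_states x0) =
           real (card (solvable_states x0)) / real (card Rev_marq) \<and>
         real (card (solvable_states x0)) / real (card Rev_marq) = 1 / (3 * 2 ^ 12)"
proof -
  obtain f\<^sub>0 g\<^sub>0 h\<^sub>0 where x0: "x0 = (f\<^sub>0, g\<^sub>0, h\<^sub>0)" by (cases x0)
  have g0: "g\<^sub>0 \<in> bundle_iso 3 SomGeom SomMat" and x0_Rev: "x0 \<in> Rev_marq"
    using assms by (auto simp: solved_state_def Rev_marq_def x0)
  let ?E = "unmatched_edges" and ?C = "untwisted_corners g\<^sub>0" and ?Z = "ext_bij CentGeom CentMat"
  have eq: "solvable_states x0 = ?E \<times> ?C \<times> ?Z"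
    unfolding x0 by (rule solvable_states_eq) (use assms x0 in simp)
  have sub: "solvable_states x0 \<subseteq> Rev_marq"
    unfolding eq Rev_marq_def by (auto simp: unmatched_edges_def untwisted_corners_def)
  have "finite CentMat"
    by (rule finite_subset[of _ "UNIV \<times> {1, 2, 3, 4}"]) (auto simp: CentMat_def)
  then have fin: "finite Rev_marq"
    unfolding Rev_marq_def
    by (intro finite_cartesian_product finite_edge_iso finite_corner_iso finite_ext_bij finite_cubies)
  have card: "card Rev_marq = 3 * 2 ^ 12 * card (solvable_states x0)"
    unfolding eq Rev_marq_def card_cartesian_product card_edge_isos card_corner_isos[OF g0]
    by simp
  have pos: "card Rev_marq > 0" using fin x0_Rev by (auto simp: card_gt_0_iff)
  have "measure_pmf.prob (pmf_of_set Rev_marq) (solvable_states x0)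
      = real (card (Rev_marq \<inter> solvable_states x0)) / real (card Rev_marq)"
    by (rule measure_pmf_of_set) (use fin x0_Rev in auto)
  also have "Rev_marq \<inter> solvable_states x0 = solvable_states x0" using sub by blast
  finally have "measure_pmf.prob (pmf_of_set Rev_marq) (solvable_states x0)
      = real (card (solvable_states x0)) / real (card Rev_marq)" .
  moreover have "real (card (solvable_states x0)) / real (card Rev_marq) = 1 / (3 * 2 ^ 12)"
    using pos unfolding card by simp
  ultimately show ?thesis ..
qed

end
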